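(* Let $\Gamma$ be a star graph, let $\psi\in\ker(-\Delta_\Gamma-\mu_2(\Gamma))$ be nontrivial (and real-valued), and let $x,y\in\Gamma$ be such that $\psi$ takes its global maximum at $x$ and its global minimum at $y$. Then $$\mathrm{dist}(x,y)=\operatorname{diam}\Gamma .$$
   Context: A metric graph $\Gamma$ is given by a finite connected discrete graph with vertex set $\mathcal V$ and edge set $\mathcal E$, where each edge $e$ is assigned a length $L(e)\in(0,\infty)$ and identified with the interval $[0,L(e)]$, the endpoints $0$ and $L(e)$ corresponding to the originating vertex $o(e)$ and terminal vertex $t(e)$ of $e$; with the natural path metric $\mathrm{dist}$, $\Gamma$ is a compact metric space, and $\operatorname{diam}\Gamma=\max\{\mathrm{dist}(x,y):x,y\in\Gamma\}$. A star graph is a metric graph with $E$ edges having a vertex $v_0$ of degree $E$ and $E$ vertices of degree one (each joined to $v_0$ by one edge); the edge lengths are arbitrary. The standard Laplacian $-\Delta_\Gamma$ in $L^2(\Gamma)=\bigoplus_{e}L^2(0,L(e))$ acts as $f\mapsto -f_e''$ on every edge ($f_e:=f|_e$), on the domain of functions $f$ with $f_e\in H^2(0,L(e))$ for all $e$, continuous on $\Gamma$, and satisfying the Kirchhoff condition $\sum_{t(e)=v} f_e'(L(e)) - \sum_{o(e)=v} f_e'(0)=0$ at each vertex $v$. Its eigenvalues, counted with multiplicities, are $0=\mu_1(\Gamma)<\mu_2(\Gamma)\le\mu_3(\Gamma)\le\dots$. Eigenfunctions are always taken real-valued. *)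

theory Defs
  imports
    "HOL-Analysis.Analysis"
    "HOL-Library.Function_Algebras"
    "Graph_Theory.Digraph_Component"
begin

section \<open>Metric graphs\<close>

text \<open>
  The underlying discrete graph is a finite digraph, possibly with loops and parallel arcs; the
  arc \<open>e\<close> runs from \<open>o(e) = tail G e\<close> to \<open>t(e) = head G e\<close> and is identified with \<open>[0, L e]\<close>.
  The orientation only serves to parametrise the edges: connectedness refers to the underlying
  undirected graph.
\<close>

locale metric_graph = fin_digraph G for G :: "('v, 'e) pre_digraph" +
  fixes L :: "'e \<Rightarrow> real"
  assumes connected: "Digraph_Component.connected G"
    and length_pos: "e \<in> arcs G \<Longrightarrow> 0 < L e"

text \<open>
  Every point of the metric graph is either a vertex or an interior point of a unique edge, at a
  distance \<open>s\<close> with \<open>0 < s < L e\<close> from the originating vertex. The map \<open>edge_pt\<close> is the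
  identification of \<open>[0, L e]\<close> with the closed edge \<open>e\<close>.
\<close>

datatype ('v, 'e) mg_point = Vertex 'v | Interior 'e real

definition mg_points :: "('v, 'e) pre_digraph \<Rightarrow> ('e \<Rightarrow> real) \<Rightarrow> ('v, 'e) mg_point set" where
  "mg_points G L = Vertex ` verts G \<union> {Interior e s | e s. e \<in> arcs G \<and> 0 < s \<and> s < L e}"

definition edge_pt :: "('v, 'e) pre_digraph \<Rightarrow> ('e \<Rightarrow> real) \<Rightarrow> 'e \<Rightarrow> real \<Rightarrow> ('v, 'e) mg_point" where
  "edge_pt G L e s =
     (if s = 0 then Vertex (tail G e) else if s = L e then Vertex (head G e) else Interior e s)"

text \<open>
  \<open>mg_path G L x l y\<close>: some path from \<open>x\<close> to \<open>y\<close>, composed of finitely many segments each of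
  which lies in one closed edge, has total length \<open>l\<close>.
\<close>

inductive mg_path :: "('v, 'e) pre_digraph \<Rightarrow> ('e \<Rightarrow> real) \<Rightarrow>
    ('v, 'e) mg_point \<Rightarrow> real \<Rightarrow> ('v, 'e) mg_point \<Rightarrow> bool" for G L where
  mg_path_refl: "x \<in> mg_points G L \<Longrightarrow> mg_path G L x 0 x"
| mg_path_step: "e \<in> arcs G \<Longrightarrow> s \<in> {0..L e} \<Longrightarrow> t \<in> {0..L e} \<Longrightarrow>
    mg_path G L (edge_pt G L e t) l y \<Longrightarrow> mg_path G L (edge_pt G L e s) (\<bar>s - t\<bar> + l) y"

definition mg_dist :: "('v, 'e) pre_digraph \<Rightarrow> ('e \<Rightarrow> real) \<Rightarrow>
    ('v, 'e) mg_point \<Rightarrow> ('v, 'e) mg_point \<Rightarrow> real" where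
  "mg_dist G L x y = Inf {l. mg_path G L x l y}"

definition mg_diam :: "('v, 'e) pre_digraph \<Rightarrow> ('e \<Rightarrow> real) \<Rightarrow> real" where
  "mg_diam G L = Sup {mg_dist G L x y | x y. x \<in> mg_points G L \<and> y \<in> mg_points G L}"

definition vertex_degree :: "('v, 'e) pre_digraph \<Rightarrow> 'v \<Rightarrow> nat" where
  "vertex_degree G v = in_degree G v + out_degree G v"

text \<open>
  A star graph has at least one edge. One edge gives an interval (either end may serve as \<open>v0\<close>),
  two edges give an interval with a vertex of degree two in its interior. The edges may be
  oriented towards or away from \<open>v0\<close>.
\<close>

definition star_graph :: "('v, 'e) pre_digraph \<Rightarrow> ('e \<Rightarrow> real) \<Rightarrow> bool" where
  "star_graph G L \<longleftrightarrow> metric_graph G L \<and> arcs G \<noteq> {} \<and>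
     (\<exists>v0\<in>verts G. vertex_degree G v0 = card (arcs G) \<and>
        card (verts G - {v0}) = card (arcs G) \<and>
        (\<forall>v\<in>verts G - {v0}. vertex_degree G v = 1 \<and>
           (\<exists>!e. e \<in> arcs G \<and> {tail G e, head G e} = {v0, v})))"


section \<open>The standard Laplacian\<close>

text \<open>
  \<open>has_L2_deriv2 l f g\<close>: \<open>f\<close> belongs to \<open>H\<^sup>2(0, l)\<close> and \<open>g\<close> represents \<open>f'' \<in> L\<^sup>2(0, l)\<close>.
  In one dimension, \<open>H\<^sup>2(0, l)\<close> consists of the functions that are continuously differentiable on
  \<open>[0, l]\<close> and whose derivative is absolutely continuous with a square-integrable derivative,
  that is, \<open>f'\<close> is an indefinite integral of some \<open>g \<in> L\<^sup>2(0, l)\<close>. At the end points, \<open>f'\<close> is the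
  one-sided derivative. The condition is invariant under changing \<open>g\<close> on a null set.
\<close>

definition has_L2_deriv2 :: "real \<Rightarrow> (real \<Rightarrow> real) \<Rightarrow> (real \<Rightarrow> real) \<Rightarrow> bool" where
  "has_L2_deriv2 l f g \<longleftrightarrow>
     g \<in> borel_measurable (lebesgue_on {0..l}) \<and>
     integrable (lebesgue_on {0..l}) (\<lambda>s. (g s)\<^sup>2) \<and>
     (\<exists>f'. (\<forall>s\<in>{0..l}. (f has_real_derivative f' s) (at s within {0..l})) \<and>
           (\<forall>s\<in>{0..l}. (g has_integral (f' s - f' 0)) {0..s}))"

definition H2 :: "real \<Rightarrow> (real \<Rightarrow> real) set" where
  "H2 l = {f. \<exists>g. has_L2_deriv2 l f g}"

definition edge_fun :: "('v, 'e) pre_digraph \<Rightarrow> ('e \<Rightarrow> real) \<Rightarrow>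
    (('v, 'e) mg_point \<Rightarrow> real) \<Rightarrow> 'e \<Rightarrow> real \<Rightarrow> real" where
  "edge_fun G L f e s = f (edge_pt G L e s)"

definition edge_deriv :: "('v, 'e) pre_digraph \<Rightarrow> ('e \<Rightarrow> real) \<Rightarrow>
    (('v, 'e) mg_point \<Rightarrow> real) \<Rightarrow> 'e \<Rightarrow> real \<Rightarrow> real" where
  "edge_deriv G L f e s = vector_derivative (edge_fun G L f e) (at s within {0..L e})"

definition mg_continuous :: "('v, 'e) pre_digraph \<Rightarrow> ('e \<Rightarrow> real) \<Rightarrow>
    (('v, 'e) mg_point \<Rightarrow> real) \<Rightarrow> bool" where
  "mg_continuous G L f \<longleftrightarrow>
     (\<forall>x\<in>mg_points G L. \<forall>\<epsilon>>0. \<exists>\<delta>>0. \<forall>y\<in>mg_points G L.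
        mg_dist G L x y < \<delta> \<longrightarrow> \<bar>f y - f x\<bar> < \<epsilon>)"

definition kirchhoff :: "('v, 'e) pre_digraph \<Rightarrow> ('e \<Rightarrow> real) \<Rightarrow>
    (('v, 'e) mg_point \<Rightarrow> real) \<Rightarrow> 'v \<Rightarrow> bool" where
  "kirchhoff G L f v \<longleftrightarrow>
     (\<Sum>e\<in>in_arcs G v. edge_deriv G L f e (L e)) - (\<Sum>e\<in>out_arcs G v. edge_deriv G L f e 0) = 0"

text \<open>
  Functions on the metric graph are represented by functions on the whole type \<open>mg_point\<close> that
  vanish outside \<open>mg_points G L\<close>, so that they are determined by their values on the graph and
  eigenspaces have the right dimension.
\<close>

definition laplacian_domain :: "('v, 'e) pre_digraph \<Rightarrow> ('e \<Rightarrow> real) \<Rightarrow>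
    (('v, 'e) mg_point \<Rightarrow> real) set" where
  "laplacian_domain G L =
     {f. (\<forall>x. x \<notin> mg_points G L \<longrightarrow> f x = 0) \<and>
         (\<forall>e\<in>arcs G. edge_fun G L f e \<in> H2 (L e)) \<and>
         mg_continuous G L f \<and>
         (\<forall>v\<in>verts G. kirchhoff G L f v)}"

text \<open>
  \<open>neg_laplacian G L f h\<close>: \<open>f\<close> is in the domain of \<open>-\<Delta>\<close> and \<open>h\<close> represents \<open>-\<Delta> f \<in> L\<^sup>2\<close>.
\<close>

definition neg_laplacian :: "('v, 'e) pre_digraph \<Rightarrow> ('e \<Rightarrow> real) \<Rightarrow>
    (('v, 'e) mg_point \<Rightarrow> real) \<Rightarrow> (('v, 'e) mg_point \<Rightarrow> real) \<Rightarrow> bool" where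
  "neg_laplacian G L f h \<longleftrightarrow> f \<in> laplacian_domain G L \<and>
     (\<forall>e\<in>arcs G. has_L2_deriv2 (L e) (edge_fun G L f e) (\<lambda>s. - edge_fun G L h e s))"

definition eigenspace :: "('v, 'e) pre_digraph \<Rightarrow> ('e \<Rightarrow> real) \<Rightarrow> real \<Rightarrow>
    (('v, 'e) mg_point \<Rightarrow> real) set" where
  "eigenspace G L \<nu> = {f. neg_laplacian G L f (\<lambda>x. \<nu> * f x)}"

definition eigenvalues :: "('v, 'e) pre_digraph \<Rightarrow> ('e \<Rightarrow> real) \<Rightarrow> real set" where
  "eigenvalues G L = {\<nu>. \<exists>f\<in>eigenspace G L \<nu>. f \<noteq> (\<lambda>x. 0)}"

definition eigenvalue_mult :: "('v, 'e) pre_digraph \<Rightarrow> ('e \<Rightarrow> real) \<Rightarrow> real \<Rightarrow> nat" where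
  "eigenvalue_mult G L \<nu> = vector_space.dim (\<lambda>c f x. c * f x) (eigenspace G L \<nu>)"

text \<open>
  The \<open>k\<close>-th eigenvalue (\<open>k \<ge> 1\<close>) in increasing order and counted with multiplicities: the least
  \<open>r\<close> such that the multiplicities of the eigenvalues in \<open>(-\<infinity>, r]\<close> add up to at least \<open>k\<close>.
  The infimum is attained because the spectrum is discrete and bounded below.
\<close>

definition mu :: "('v, 'e) pre_digraph \<Rightarrow> ('e \<Rightarrow> real) \<Rightarrow> nat \<Rightarrow> real" where
  "mu G L k = Inf {r. \<exists>F. finite F \<and> F \<subseteq> eigenvalues G L \<inter> {..r} \<and>
                          k \<le> (\<Sum>\<nu>\<in>F. eigenvalue_mult G L \<nu>)}"

end

theory Submission
  imports Defs
begin

text \<open>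
  Measuring each edge from its leaf, an eigenfunction for \<open>k\<^sup>2 > 0\<close> is \<open>a\<^sub>e cos (k r)\<close>, where
  \<open>a\<^sub>e cos (k l\<^sub>e)\<close> does not depend on \<open>e\<close> and the numbers \<open>a\<^sub>e sin (k l\<^sub>e)\<close> add up to zero. Let
  \<open>l\<^sub>1 \<ge> l\<^sub>2\<close> be the two largest edge lengths (\<open>l\<^sub>2 = 0\<close> if there is only one edge), so that the
  diameter is \<open>l\<^sub>1 + l\<^sub>2\<close>. There is no eigenvalue strictly between \<open>0\<close> and \<open>(pi / 2 l\<^sub>1)\<^sup>2\<close>, and
  the intermediate value theorem gives one with \<open>k \<le> pi / (l\<^sub>1 + l\<^sub>2)\<close>. For the second eigenvalue
  this pins down the signs of all cosines: on every edge the eigenfunction is monotone, and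
  comparing the amplitudes \<open>a\<^sub>e\<close> shows that its extrema are the ends of a longest path.
\<close>

section \<open>The eigenvalue equation on an edge\<close>

text \<open>The derivative \<open>f'\<close> is an explicit argument, with one-sided derivatives at
  the ends: the Kirchhoff condition needs its end values, and the equation becomes a first-order
  system.\<close>

definition edge_ode :: "real \<Rightarrow> real \<Rightarrow> (real \<Rightarrow> real) \<Rightarrow> (real \<Rightarrow> real) \<Rightarrow> bool" where
  "edge_ode \<nu> l f f' \<longleftrightarrow> (\<forall>s\<in>{0..l}. (f has_real_derivative f' s) (at s within {0..l}) \<and>
     (f' has_real_derivative - (\<nu> * f s)) (at s within {0..l}))"

lemma edge_odeD:
  assumes "edge_ode \<nu> l f f'" "s \<in> {0..l}"
  shows "(f has_real_derivative f' s) (at s within {0..l})"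
    "(f' has_real_derivative - (\<nu> * f s)) (at s within {0..l})"
  using assms by (auto simp: edge_ode_def)

lemma edge_ode_continuous:
  assumes "edge_ode \<nu> l f f'"
  shows "continuous_on {0..l} f" "continuous_on {0..l} f'"
  by (rule DERIV_continuous_on, erule edge_odeD[OF assms])+

lemma edge_ode_cong:
  assumes "edge_ode \<nu> l f f'" "\<And>s. s \<in> {0..l} \<Longrightarrow> f s = g s" "\<And>s. s \<in> {0..l} \<Longrightarrow> f' s = g' s"
  shows "edge_ode \<nu> l g g'"
  unfolding edge_ode_def
proof (intro ballI conjI)
  fix s assume s: "s \<in> {0..l}"
  show "(g has_real_derivative g' s) (at s within {0..l})"
    using has_field_derivative_transform_within[OF edge_odeD(1)[OF assms(1) s] zero_less_one s] assms(2,3) s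
    by auto
  show "(g' has_real_derivative - (\<nu> * g s)) (at s within {0..l})"
    using has_field_derivative_transform_within[OF edge_odeD(2)[OF assms(1) s] zero_less_one s] assms(2,3) s
    by auto
qed

text \<open>A second-order equation without first-order term does not see the orientation of the
  edge; only the sign of the derivative changes.\<close>

lemma edge_ode_reflect:
  assumes "edge_ode \<nu> l f f'"
  shows "edge_ode \<nu> l (\<lambda>s. f (l - s)) (\<lambda>s. - f' (l - s))"
  unfolding edge_ode_def
proof (intro ballI conjI)
  fix s assume s: "s \<in> {0..l}"
  then have s': "l - s \<in> {0..l}" by auto
  have im: "(\<lambda>s. l - s) ` {0..l} = {0..l}" by (auto simp: image_iff intro!: bexI[of _ "l - _"])
  have d: "((\<lambda>s. l - s) has_real_derivative -1) (at s within {0..l})"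
    by (auto intro!: derivative_eq_intros)
  show "((\<lambda>s. f (l - s)) has_real_derivative - f' (l - s)) (at s within {0..l})"
    using DERIV_image_chain[of f "f' (l - s)" "\<lambda>s. l - s" s "{0..l}" "-1"] d
      edge_odeD(1)[OF assms s'] im by (simp add: o_def)
  have "((\<lambda>s. f' (l - s)) has_real_derivative \<nu> * f (l - s)) (at s within {0..l})"
    using DERIV_image_chain[of f' "- (\<nu> * f (l - s))" "\<lambda>s. l - s" s "{0..l}" "-1"] d
      edge_odeD(2)[OF assms s'] im by (simp add: o_def)
  then show "((\<lambda>s. - f' (l - s)) has_real_derivative - (\<nu> * f (l - s))) (at s within {0..l})"
    by (rule DERIV_minus)
qed

text \<open>Regularity bootstrap: the weak second derivative is a multiple of the continuous
  function \<open>f\<close>, so the fundamental theorem of calculus makes it a classical one.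
  Conversely, continuity on a compact interval gives square integrability.\<close>

lemma has_L2_deriv2_iff_edge_ode:
  "has_L2_deriv2 l f (\<lambda>s. - (\<nu> * f s)) \<longleftrightarrow> (\<exists>f'. edge_ode \<nu> l f f')"
proof
  assume "has_L2_deriv2 l f (\<lambda>s. - (\<nu> * f s))"
  then obtain f' where f': "\<And>s. s \<in> {0..l} \<Longrightarrow> (f has_real_derivative f' s) (at s within {0..l})"
    and int: "\<And>s. s \<in> {0..l} \<Longrightarrow> ((\<lambda>s. - (\<nu> * f s)) has_integral (f' s - f' 0)) {0..s}"
    unfolding has_L2_deriv2_def by blast
  have "continuous_on {0..l} f"
    using f' by (rule DERIV_continuous_on)
  then have cont: "continuous_on {0..l} (\<lambda>s. - (\<nu> * f s))"
    by (intro continuous_intros)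
  have "(f' has_real_derivative - (\<nu> * f s)) (at s within {0..l})" if s: "s \<in> {0..l}" for s
  proof -
    have "((\<lambda>s. f' 0 + integral {0..s} (\<lambda>s. - (\<nu> * f s))) has_real_derivative 0 + - (\<nu> * f s))
        (at s within {0..l})"
      by (intro DERIV_add DERIV_const integral_has_real_derivative[OF cont s])
    then show ?thesis
      by (rule has_field_derivative_transform_within[where d = 1, THEN DERIV_cong])
        (use s integral_unique[OF int] in auto)
  qed
  then show "\<exists>f'. edge_ode \<nu> l f f'" unfolding edge_ode_def using f' by blast
next
  assume "\<exists>f'. edge_ode \<nu> l f f'"
  then obtain f' where ode: "edge_ode \<nu> l f f'" by auto
  have cont: "continuous_on {0..l} (\<lambda>s. - (\<nu> * f s))"
    using edge_ode_continuous[OF ode] by (intro continuous_intros) auto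
  have "((\<lambda>s. - (\<nu> * f s)) has_integral (f' s - f' 0)) {0..s}" if s: "s \<in> {0..l}" for s
  proof (rule fundamental_theorem_of_calculus)
    show "0 \<le> s" using s by auto
    fix t assume "t \<in> {0..s}"
    then have "(f' has_real_derivative - (\<nu> * f t)) (at t within {0..s})"
      using edge_odeD(2)[OF ode, of t] s by (auto intro: DERIV_subset)
    then show "(f' has_vector_derivative - (\<nu> * f t)) (at t within {0..s})"
      by (simp add: has_real_derivative_iff_has_vector_derivative)
  qed
  then show "has_L2_deriv2 l f (\<lambda>s. - (\<nu> * f s))"
    unfolding has_L2_deriv2_def using cont edge_odeD(1)[OF ode]
    by (intro conjI exI[of _ f'] ballI continuous_imp_measurable_on_sets_lebesgue
      continuous_imp_integrable_real continuous_on_power) auto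
qed

text \<open>Variation of constants: the coefficients of \<open>f\<close> in the basis \<open>cos (k s), sin (k s)\<close> have
  derivative zero.\<close>

lemma edge_ode_cos:
  assumes ode: "edge_ode (k\<^sup>2) l f f'" and k: "k \<noteq> 0" and f'0: "f' 0 = 0" and s: "s \<in> {0..l}"
  shows "f s = f 0 * cos (k * s)" "f' s = - (k * f 0 * sin (k * s))"
proof -
  \<comment> \<open>\<open>u\<close> and \<open>v\<close> are \<open>k\<close> times the cosine and
    sine coefficients of \<open>f\<close>, which avoids a division by \<open>k\<close>.\<close>
  define u where "u s = k * f s * cos (k * s) - f' s * sin (k * s)" for s
  define v where "v s = k * f s * sin (k * s) + f' s * cos (k * s)" for s
  have du: "(u has_real_derivative 0) (at t within {0..l})" if "t \<in> {0..l}" for t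
    unfolding u_def using edge_odeD[OF ode that]
    by (auto intro!: derivative_eq_intros simp: algebra_simps power2_eq_square)
  have dv: "(v has_real_derivative 0) (at t within {0..l})" if "t \<in> {0..l}" for t
    unfolding v_def using edge_odeD[OF ode that]
    by (auto intro!: derivative_eq_intros simp: algebra_simps power2_eq_square)
  obtain cu cv where "\<And>t. t \<in> {0..l} \<Longrightarrow> u t = cu" "\<And>t. t \<in> {0..l} \<Longrightarrow> v t = cv"
    using has_field_derivative_zero_constant[of "{0..l}" u] du
      has_field_derivative_zero_constant[of "{0..l}" v] dv by auto
  moreover have "0 \<in> {0..l}" using s by auto
  ultimately have "u s = u 0" "v s = v 0" using s by metis+
  then have us: "u s = k * f 0" and vs: "v s = 0" by (auto simp: u_def v_def f'0)
  have one: "cos (k * s) * cos (k * s) + sin (k * s) * sin (k * s) = 1"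
    by (metis power2_eq_square sin_cos_squared_add add.commute)
  have "k * f s = k * f s * (cos (k * s) * cos (k * s) + sin (k * s) * sin (k * s))"
    by (simp only: one mult_1_right)
  also have "\<dots> = u s * cos (k * s) + v s * sin (k * s)"
    unfolding u_def v_def by algebra
  finally show "f s = f 0 * cos (k * s)" using us vs k by simp
  have "f' s = f' s * (cos (k * s) * cos (k * s) + sin (k * s) * sin (k * s))"
    by (simp only: one mult_1_right)
  also have "\<dots> = v s * cos (k * s) - u s * sin (k * s)"
    unfolding u_def v_def by algebra
  finally show "f' s = - (k * f 0 * sin (k * s))" using us vs by simp
qed

lemma cos_edge_ode: "edge_ode (k\<^sup>2) l (\<lambda>s. a * cos (k * s)) (\<lambda>s. - (k * a * sin (k * s)))"
  unfolding edge_ode_def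
  by (auto intro!: derivative_eq_intros simp: algebra_simps power2_eq_square)

text \<open>For \<open>\<nu> \<le> 0\<close> the function \<open>f f'\<close> is nondecreasing, since its derivative is
  \<open>f'\<^sup>2 - \<nu> f\<^sup>2\<close>.\<close>

lemma edge_ode_nonpos:
  assumes ode: "edge_ode \<nu> l f f'" and \<nu>: "\<nu> \<le> 0" and "0 < l"
  shows edge_ode_nonpos_mono: "\<And>s t. 0 \<le> s \<Longrightarrow> s \<le> t \<Longrightarrow> t \<le> l \<Longrightarrow> f s * f' s \<le> f t * f' t"
    and edge_ode_nonpos_rigid:
      "\<And>s. f' 0 = 0 \<Longrightarrow> f l * f' l = 0 \<Longrightarrow> s \<in> {0..l} \<Longrightarrow> f' s = 0 \<and> \<nu> * f s = 0"
proof -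
  have deriv: "((\<lambda>s. f s * f' s) has_real_derivative (f' s)\<^sup>2 + - \<nu> * (f s)\<^sup>2) (at s within {0..l})"
    if "s \<in> {0..l}" for s
    using edge_odeD[OF ode that]
    by (auto intro!: derivative_eq_intros simp: algebra_simps power2_eq_square)
  have nonneg: "0 \<le> - \<nu> * (f s)\<^sup>2" for s
    using \<nu> by (intro mult_nonneg_nonneg) auto
  show mono: "f s * f' s \<le> f t * f' t" if st: "0 \<le> s" "s \<le> t" "t \<le> l" for s t
  proof (rule DERIV_nonneg_imp_increasing_open[OF st(2)])
    show "\<exists>y. ((\<lambda>s. f s * f' s) has_real_derivative y) (at u) \<and> 0 \<le> y" if u: "s < u" "u < t" for u
    proof (intro exI conjI)
      have "at u within {0..l} = at u"
        using u st by (intro at_within_interior) auto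
      then show "((\<lambda>s. f s * f' s) has_real_derivative (f' u)\<^sup>2 + - \<nu> * (f u)\<^sup>2) (at u)"
        using deriv[of u] u st by auto
    qed (intro add_nonneg_nonneg nonneg zero_le_power2)
    show "continuous_on {s..t} (\<lambda>s. f s * f' s)"
      using edge_ode_continuous[OF ode] st
      by (intro continuous_on_mult) (auto elim: continuous_on_subset)
  qed
  show "f' s = 0 \<and> \<nu> * f s = 0" if "f' 0 = 0" "f l * f' l = 0" and s: "s \<in> {0..l}" for s
  proof -
    \<comment> \<open>Monotonicity squeezes the product between its two zero end values. Its
      derivative is then zero as well, and that derivative is a sum of two nonnegative
      terms.\<close>
    have zero: "f t * f' t = 0" if t: "t \<in> {0..l}" for t
      using mono[of 0 t] mono[of t l] \<open>f' 0 = 0\<close> \<open>f l * f' l = 0\<close> t by auto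
    have "((\<lambda>s. f s * f' s) has_real_derivative 0) (at s within {0..l})"
      by (rule has_field_derivative_transform_within[of "\<lambda>s. 0" _ _ _ 1]) (use zero s in auto)
    then have "(f' s)\<^sup>2 + - \<nu> * (f s)\<^sup>2 = 0"
      using vector_derivative_unique_within_closed_interval[of 0 l s] \<open>0 < l\<close> s deriv[OF s]
      unfolding has_real_derivative_iff_has_vector_derivative box_real by blast
    then show ?thesis
      using add_nonneg_eq_0_iff[OF zero_le_power2[of "f' s"] nonneg[of s]] by auto
  qed
qed

section \<open>Auxiliary facts on the cosine and on dimensions of function spaces\<close>

lemma abs_cos_diff_le: "\<bar>cos x - cos y\<bar> \<le> \<bar>x - y\<bar>" for x y :: real
  using field_differentiable_bound[of UNIV cos "\<lambda>x. - sin x" 1 x y]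
  by (auto intro!: derivative_eq_intros)

lemma vector_space_fun: "vector_space (\<lambda>(c::real) (f :: 'a \<Rightarrow> real) x. c * f x)"
  by unfold_locales (auto simp: fun_eq_iff algebra_simps)

global_interpretation real_fun: vector_space "\<lambda>(c::real) (f :: 'a \<Rightarrow> real) x. c * f x"
  by (rule vector_space_fun)

text \<open>The finite spanning set matters: \<open>dim\<close> is the \<open>card\<close> of a
  basis, which is 0 for an infinite one.\<close>

lemma (in vector_space) dim_pos:
  assumes "V \<subseteq> span W" "finite W" "v \<in> V" "v \<noteq> 0"
  shows "0 < dim V"
proof -
  obtain B where B: "B \<subseteq> V" "independent B" "V \<subseteq> span B" "card B = dim V"
    by (rule basis_exists)
  then have "finite B" using independent_span_bound[of W B] assms by auto
  moreover have "B \<noteq> {}" using B assms by auto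
  ultimately show ?thesis using B(4) by (metis card_gt_0_iff)
qed

section \<open>Star graphs\<close>

text \<open>Edges are labelled by their leaves, and \<open>ends\<close> is an equation between sets
  so that each edge may point towards \<open>v0\<close> or away from it.\<close>

locale star_metric_graph = metric_graph G L for G :: "('v, 'e) pre_digraph" and L +
  fixes v0 :: 'v and leaf :: "'e \<Rightarrow> 'v"
  assumes v0: "v0 \<in> verts G"
    and leaf: "bij_betw leaf (arcs G) (verts G - {v0})"
    and ends: "e \<in> arcs G \<Longrightarrow> {tail G e, head G e} = {v0, leaf e}"
    and nonempty: "arcs G \<noteq> {}"

text \<open>Choosing for each leaf an edge that joins it to \<open>v0\<close> is injective, because
  the pair of ends determines the leaf. Equal cardinalities make the choice surjective, and
  \<open>leaf\<close> is its inverse.\<close>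

lemma star_graphE:
  assumes "star_graph G L"
  obtains v0 leaf where "star_metric_graph G L v0 leaf"
proof -
  have mg: "metric_graph G L" and ne: "arcs G \<noteq> {}"
    using assms by (simp_all add: star_graph_def)
  obtain v0 where v0: "v0 \<in> verts G" and card: "card (verts G - {v0}) = card (arcs G)"
    and ex1: "\<forall>v\<in>verts G - {v0}. vertex_degree G v = 1 \<and>
      (\<exists>!e. e \<in> arcs G \<and> {tail G e, head G e} = {v0, v})"
    using assms unfolding star_graph_def by (elim conjE bexE) (rule that)
  have ex: "\<exists>e. e \<in> arcs G \<and> {tail G e, head G e} = {v0, v}" if "v \<in> verts G - {v0}" for v
    using bspec[OF ex1 that] by (elim conjE) (rule ex1_implies_ex)
  interpret metric_graph G L by (rule mg)
  obtain g where g: "\<And>v. v \<in> verts G - {v0} \<Longrightarrow> g v \<in> arcs G \<and> {tail G (g v), head G (g v)} = {v0, v}"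
    using ex by metis
  have "inj_on g (verts G - {v0})"
    by (rule inj_onI) (use g in \<open>metis DiffD2 doubleton_eq_iff singletonI\<close>)
  moreover from this have "g ` (verts G - {v0}) = arcs G"
    using g card by (intro card_subset_eq) (auto simp: card_image)
  ultimately have bij: "bij_betw g (verts G - {v0}) (arcs G)"
    by (simp add: bij_betw_def)
  define leaf where "leaf = the_inv_into (verts G - {v0}) g"
  have "star_metric_graph G L v0 leaf"
  proof
    show "bij_betw leaf (arcs G) (verts G - {v0})"
      unfolding leaf_def by (rule bij_betw_the_inv_into[OF bij])
    fix e assume "e \<in> arcs G"
    then obtain v where "v \<in> verts G - {v0}" "e = g v" using bij by (auto simp: bij_betw_def)
    then show "{tail G e, head G e} = {v0, leaf e}"
      using g[of v] bij by (simp add: leaf_def the_inv_into_f_f bij_betw_def)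
  qed (use v0 ne in auto)
  then show ?thesis by (rule that)
qed

context star_metric_graph
begin

lemma leaf_ne [simp]: "e \<in> arcs G \<Longrightarrow> leaf e \<noteq> v0"
  and leaf_in [simp]: "e \<in> arcs G \<Longrightarrow> leaf e \<in> verts G"
  using bij_betwE[OF leaf] by auto

lemma leaf_eq_iff [simp]: "e \<in> arcs G \<Longrightarrow> e' \<in> arcs G \<Longrightarrow> leaf e = leaf e' \<longleftrightarrow> e = e'"
  using bij_betw_imp_inj_on[OF leaf] by (auto dest: inj_onD)

lemma ends_cases:
  assumes "e \<in> arcs G"
  obtains "head G e = v0" "tail G e = leaf e" | "head G e = leaf e" "tail G e = v0"
  using ends[OF assms] by (auto simp: doubleton_eq_iff)

lemma tail_eq_v0:
  assumes "e \<in> arcs G" shows "tail G e = v0 \<longleftrightarrow> head G e \<noteq> v0"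
  using ends_cases[OF assms] leaf_ne[OF assms] by metis

lemma head_eq_leaf:
  assumes "e \<in> arcs G" "e' \<in> arcs G" shows "head G e' = leaf e \<longleftrightarrow> e' = e \<and> head G e \<noteq> v0"
  using assms(2)
proof (cases rule: ends_cases)
  case 1
  then show ?thesis using assms leaf_ne[of e] by metis
next
  case 2
  then show ?thesis using assms leaf_ne[of e] by (metis leaf_eq_iff)
qed

lemma tail_eq_leaf:
  assumes "e \<in> arcs G" "e' \<in> arcs G" shows "tail G e' = leaf e \<longleftrightarrow> e' = e \<and> head G e = v0"
  using assms(2)
proof (cases rule: ends_cases)
  case 1
  then show ?thesis using assms leaf_ne[of e] by (metis leaf_eq_iff)
next
  case 2
  then show ?thesis using assms leaf_ne[of e] by metis
qed

section \<open>Points of a star in the coordinate measured from the leaf\<close>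

definition flip :: "'e \<Rightarrow> real \<Rightarrow> real" where
  "flip e r = (if head G e = v0 then r else L e - r)"

text \<open>The point of the edge \<open>e\<close> at distance \<open>r\<close> from the leaf.\<close>

definition leaf_pt :: "'e \<Rightarrow> real \<Rightarrow> ('v, 'e) mg_point" where
  "leaf_pt e r = edge_pt G L e (flip e r)"

text \<open>As an involution, \<open>flip e\<close> converts the edge parameter into the distance
  from the leaf and back; as an isometry of \<open>{0..L e}\<close>, it removes the orientation from
  all length computations.\<close>

lemma flip_flip [simp]: "flip e (flip e r) = r"
  by (simp add: flip_def)

lemma flip_in [simp]: "flip e r \<in> {0..L e} \<longleftrightarrow> r \<in> {0..L e}"
  by (auto simp: flip_def)

lemma flip_diff [simp]: "\<bar>flip e r - flip e r'\<bar> = \<bar>r - r'\<bar>"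
  by (auto simp: flip_def)

lemma edge_pt_eq: "edge_pt G L e s = leaf_pt e (flip e s)"
  by (simp add: leaf_pt_def)

lemma leaf_pt_0: "e \<in> arcs G \<Longrightarrow> leaf_pt e 0 = Vertex (leaf e)"
  and leaf_pt_L: "e \<in> arcs G \<Longrightarrow> leaf_pt e (L e) = Vertex v0"
  using length_pos[of e] tail_eq_v0[of e] head_eq_leaf[of e e] tail_eq_leaf[of e e]
  by (cases "head G e = v0"; simp add: leaf_pt_def flip_def edge_pt_def)+

lemma leaf_pt_interior: "0 < r \<Longrightarrow> r < L e \<Longrightarrow> leaf_pt e r = Interior e (flip e r)"
  by (auto simp: leaf_pt_def flip_def edge_pt_def)

lemma leaf_pt_in:
  assumes "e \<in> arcs G" "r \<in> {0..L e}"
  shows "leaf_pt e r \<in> mg_points G L"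
proof -
  consider "r = 0" | "r = L e" | "0 < r" "r < L e" using assms by force
  then show ?thesis
  proof cases
    case 3
    then have "0 < flip e r" "flip e r < L e" by (simp_all add: flip_def)
    then show ?thesis using 3 assms by (simp add: leaf_pt_interior mg_points_def)
  qed (use assms v0 in \<open>simp_all add: leaf_pt_0 leaf_pt_L mg_points_def\<close>)
qed

lemma mg_points_cases:
  assumes "z \<in> mg_points G L"
  obtains e r where "e \<in> arcs G" "r \<in> {0..L e}" "z = leaf_pt e r"
proof -
  consider "z = Vertex v0" | v where "z = Vertex v" "v \<in> verts G - {v0}"
    | e s where "z = Interior e s" "e \<in> arcs G" "0 < s" "s < L e"
    using assms by (auto simp: mg_points_def)
  then show ?thesis
  proof cases
    case 1
    obtain e where "e \<in> arcs G" using nonempty by blast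
    then show ?thesis
      using 1 leaf_pt_L length_pos that[of e "L e"] by (auto simp: less_imp_le)
  next
    case 2
    then obtain e where "e \<in> arcs G" "v = leaf e" using leaf by (auto simp: bij_betw_def)
    then show ?thesis using 2 leaf_pt_0 length_pos that[of e 0] by (auto simp: less_imp_le)
  next
    case 3
    then show ?thesis using that[of e "flip e s"] flip_in[of e s]
      by (auto simp: leaf_pt_def edge_pt_def)
  qed
qed

text \<open>Closed edges meet only in \<open>v0\<close>, the point at parameter \<open>L e\<close>
  on each of them; hence the second alternative leaves \<open>e\<close> and \<open>e'\<close>
  unrelated.\<close>

lemma leaf_pt_eqD:
  assumes "leaf_pt e r = leaf_pt e' r'" "e \<in> arcs G" "e' \<in> arcs G" "r \<in> {0..L e}" "r' \<in> {0..L e'}"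
  shows "e = e' \<and> r = r' \<or> r = L e \<and> r' = L e'"
proof -
  have "r = 0 \<or> r = L e \<or> 0 < r \<and> r < L e" "r' = 0 \<or> r' = L e' \<or> 0 < r' \<and> r' < L e'"
    using assms by auto
  then show ?thesis
    using assms length_pos[of e] length_pos[of e'] leaf_ne[of e] leaf_ne[of e']
    by (elim disjE) (auto simp: leaf_pt_0 leaf_pt_L leaf_pt_interior leaf_ne[symmetric] dest: arg_cong[of _ _ "flip e"] simp del: leaf_ne)
qed

section \<open>The path metric, bounded from below by Lipschitz functions\<close>

lemma mg_path_lipschitz:
  assumes "mg_path G L x l y"
    and "\<And>e r r'. e \<in> arcs G \<Longrightarrow> r \<in> {0..L e} \<Longrightarrow> r' \<in> {0..L e} \<Longrightarrow>
      \<bar>f (leaf_pt e r) - f (leaf_pt e r')\<bar> \<le> C * \<bar>r - r'\<bar>"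
  shows "\<bar>f x - f y\<bar> \<le> C * l"
  using assms(1)
proof induction
  case (mg_path_step e s t l y)
  have "\<bar>f (edge_pt G L e s) - f (edge_pt G L e t)\<bar> \<le> C * \<bar>s - t\<bar>"
    using assms(2)[of e "flip e s" "flip e t"] mg_path_step.hyps
    by (simp only: edge_pt_eq flip_in flip_diff)
  with mg_path_step.IH show ?case by (simp add: distrib_left)
qed simp

lemma mg_path_nonneg: "mg_path G L x l y \<Longrightarrow> 0 \<le> l"
  by (induction rule: mg_path.induct) auto

lemma bdd_below_mg_path: "bdd_below {l. mg_path G L x l y}"
  using mg_path_nonneg by (intro bdd_belowI[of _ 0]) auto

lemma mg_path_leaf_pt_step:
  assumes "e \<in> arcs G" "r \<in> {0..L e}" "t \<in> {0..L e}" "mg_path G L (leaf_pt e t) l y"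
  shows "mg_path G L (leaf_pt e r) (\<bar>r - t\<bar> + l) y"
  using mg_path.mg_path_step[of e G "flip e r" L "flip e t" l y] assms
  by (simp only: leaf_pt_def flip_in flip_diff)

lemma mg_path_same_edge:
  assumes "e \<in> arcs G" "r \<in> {0..L e}" "t \<in> {0..L e}"
  shows "mg_path G L (leaf_pt e r) \<bar>r - t\<bar> (leaf_pt e t)"
  using mg_path_leaf_pt_step[OF assms mg_path_refl[OF leaf_pt_in]] assms by simp

text \<open>The route passes through \<open>v0\<close>. The case \<open>e = e'\<close> is included:
  there the route may be a detour, but it still shows that any two points are joined.\<close>

lemma mg_path_two_edges:
  assumes "e \<in> arcs G" "r \<in> {0..L e}" "e' \<in> arcs G" "r' \<in> {0..L e'}"
  shows "mg_path G L (leaf_pt e r) ((L e - r) + (L e' - r')) (leaf_pt e' r')"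
proof -
  have "mg_path G L (leaf_pt e (L e)) \<bar>L e' - r'\<bar> (leaf_pt e' r')"
    using mg_path_same_edge[of e' "L e'" r'] assms by (simp add: leaf_pt_L)
  then show ?thesis
    using mg_path_leaf_pt_step[of e r "L e" "\<bar>L e' - r'\<bar>" "leaf_pt e' r'"] assms
    by (simp add: abs_of_nonneg abs_of_nonpos)
qed

lemma mg_path_exists:
  assumes "x \<in> mg_points G L" "y \<in> mg_points G L"
  shows "{l. mg_path G L x l y} \<noteq> {}"
  using assms mg_path_two_edges by (elim mg_points_cases) blast

lemma mg_dist_le: "mg_path G L x l y \<Longrightarrow> mg_dist G L x y \<le> l"
  unfolding mg_dist_def using bdd_below_mg_path by (auto intro: cInf_lower)

text \<open>Every path length is at least \<open>\<bar>f x - f y\<bar> / C\<close>, and so is the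
  infimum. A lower bound for a distance thus only requires a suitable test function.\<close>

lemma mg_dist_lipschitz:
  assumes "x \<in> mg_points G L" "y \<in> mg_points G L"
    and "\<And>e r r'. e \<in> arcs G \<Longrightarrow> r \<in> {0..L e} \<Longrightarrow> r' \<in> {0..L e} \<Longrightarrow>
      \<bar>f (leaf_pt e r) - f (leaf_pt e r')\<bar> \<le> C * \<bar>r - r'\<bar>"
    and C: "0 < C"
  shows "\<bar>f x - f y\<bar> \<le> C * mg_dist G L x y"
proof -
  have "\<bar>f x - f y\<bar> / C \<le> mg_dist G L x y"
    unfolding mg_dist_def using mg_path_exists[OF assms(1,2)] mg_path_lipschitz[where f = f, OF _ assms(3)] C
    by (intro cInf_greatest) (auto simp: field_simps)
  then show ?thesis using C by (simp add: field_simps)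
qed

lemma mg_continuous_lipschitz:
  assumes "\<And>e r r'. e \<in> arcs G \<Longrightarrow> r \<in> {0..L e} \<Longrightarrow> r' \<in> {0..L e} \<Longrightarrow>
      \<bar>f (leaf_pt e r) - f (leaf_pt e r')\<bar> \<le> C * \<bar>r - r'\<bar>"
    and C: "0 < C"
  shows "mg_continuous G L f"
  unfolding mg_continuous_def
proof (intro ballI allI impI)
  fix x and \<epsilon> :: real assume x: "x \<in> mg_points G L" and \<epsilon>: "0 < \<epsilon>"
  have "\<bar>f y - f x\<bar> < \<epsilon>" if y: "y \<in> mg_points G L" and d: "mg_dist G L x y < \<epsilon> / C" for y
    using mg_dist_lipschitz[where f = f, OF x y assms] d C by (force simp: field_simps)
  then show "\<exists>\<delta>>0. \<forall>y\<in>mg_points G L. mg_dist G L x y < \<delta> \<longrightarrow> \<bar>f y - f x\<bar> < \<epsilon>"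
    using \<epsilon> C by (intro exI[of _ "\<epsilon> / C"]) auto
qed

text \<open>Well defined because different edges are identified only at \<open>v0\<close>, where all
  the \<open>g e\<close> take the value \<open>c\<close>. The zero extension is the convention of
  \<open>laplacian_domain\<close>.\<close>

lemma glue_function:
  assumes "\<And>e. e \<in> arcs G \<Longrightarrow> g e (L e) = (c :: real)"
  obtains f where "\<forall>e\<in>arcs G. \<forall>r\<in>{0..L e}. f (leaf_pt e r) = g e r"
    and "\<forall>z. z \<notin> mg_points G L \<longrightarrow> f z = 0"
proof -
  have "\<exists>u. (z \<notin> mg_points G L \<longrightarrow> u = 0) \<and>
      (\<forall>e\<in>arcs G. \<forall>r\<in>{0..L e}. z = leaf_pt e r \<longrightarrow> u = g e r)" for z
  proof (cases "z \<in> mg_points G L")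
    case True
    then obtain e r where er: "e \<in> arcs G" "r \<in> {0..L e}" "z = leaf_pt e r" by (rule mg_points_cases)
    have "g e r = g e' r'" if "e' \<in> arcs G" "r' \<in> {0..L e'}" "z = leaf_pt e' r'" for e' r'
      using leaf_pt_eqD[of e r e' r'] er that assms by auto
    then show ?thesis using True by blast
  next
    case False
    then show ?thesis using leaf_pt_in by blast
  qed
  then obtain f where "\<And>z. (z \<notin> mg_points G L \<longrightarrow> f z = 0) \<and>
      (\<forall>e\<in>arcs G. \<forall>r\<in>{0..L e}. z = leaf_pt e r \<longrightarrow> f z = g e r)"
    by metis
  then show ?thesis using that by blast
qed

section \<open>Eigenspaces of a star graph\<close>

text \<open>The chain rule: if \<open>d\<close> is the derivative of \<open>h\<close>, this is the
  derivative of \<open>h\<close> composed with \<open>flip e\<close>.\<close>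

definition flip_deriv :: "'e \<Rightarrow> (real \<Rightarrow> real) \<Rightarrow> real \<Rightarrow> real" where
  "flip_deriv e d r = (if head G e = v0 then d r else - d (L e - r))"

lemma edge_ode_flip:
  assumes "edge_ode \<nu> (L e) h d"
  shows "edge_ode \<nu> (L e) (\<lambda>r. h (flip e r)) (flip_deriv e d)"
  using edge_ode_reflect[OF assms] assms
  by (cases "head G e = v0") (auto simp: flip_def flip_deriv_def[abs_def])

lemma edge_ode_leaf_pt_iff:
  "(\<exists>d. edge_ode \<nu> (L e) (edge_fun G L f e) d) \<longleftrightarrow> (\<exists>d. edge_ode \<nu> (L e) (\<lambda>r. f (leaf_pt e r)) d)"
proof -
  have "(\<lambda>r. edge_fun G L f e (flip e r)) = (\<lambda>r. f (leaf_pt e r))"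
    "(\<lambda>r. f (leaf_pt e (flip e r))) = edge_fun G L f e"
    by (simp_all add: edge_fun_def[abs_def] edge_pt_eq)
  then show ?thesis
    using edge_ode_flip[of \<nu> e "edge_fun G L f e"] edge_ode_flip[of \<nu> e "\<lambda>r. f (leaf_pt e r)"]
    by metis
qed

lemma edge_deriv_eq:
  assumes e: "e \<in> arcs G" and ode: "edge_ode \<nu> (L e) (\<lambda>r. f (leaf_pt e r)) d" and s: "s \<in> {0..L e}"
  shows "edge_deriv G L f e s = flip_deriv e d s"
proof -
  have "edge_ode \<nu> (L e) (edge_fun G L f e) (flip_deriv e d)"
    using edge_ode_flip[OF ode] by (simp add: edge_fun_def[abs_def] edge_pt_eq)
  then show ?thesis
    unfolding edge_deriv_def using s length_pos[OF e]
    by (intro vector_derivative_within_closed_interval)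
      (auto simp: edge_ode_def has_real_derivative_iff_has_vector_derivative)
qed

text \<open>Measured from the leaves, all edges run into \<open>v0\<close>, so the signs of incoming
  and outgoing arcs are absorbed by \<open>flip_deriv\<close> and one plain sum remains. A leaf
  meets a single edge, which gives a Neumann condition.\<close>

lemma kirchhoff_iff:
  assumes ode: "\<And>e. e \<in> arcs G \<Longrightarrow> edge_ode \<nu> (L e) (\<lambda>r. f (leaf_pt e r)) (f' e)"
  shows "(\<forall>v\<in>verts G. kirchhoff G L f v) \<longleftrightarrow> (\<forall>e\<in>arcs G. f' e 0 = 0) \<and> (\<Sum>e\<in>arcs G. f' e (L e)) = 0"
proof -
  have D0: "edge_deriv G L f e 0 = flip_deriv e (f' e) 0"
    and DL: "edge_deriv G L f e (L e) = flip_deriv e (f' e) (L e)" if "e \<in> arcs G" for e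
    using edge_deriv_eq[OF that ode[OF that]] length_pos[OF that] by auto
  have "kirchhoff G L f v0 \<longleftrightarrow> (\<Sum>e\<in>arcs G. f' e (L e)) = 0"
  proof -
    have inout: "in_arcs G v0 = {e\<in>arcs G. head G e = v0}" "out_arcs G v0 = {e\<in>arcs G. head G e \<noteq> v0}"
      by (intro set_eqI; simp add: tail_eq_v0 cong: conj_cong)+
    have "(\<Sum>e\<in>in_arcs G v0. edge_deriv G L f e (L e)) = (\<Sum>e\<in>in_arcs G v0. f' e (L e))"
      by (intro sum.cong) (simp_all add: DL flip_deriv_def inout)
    moreover have "(\<Sum>e\<in>out_arcs G v0. edge_deriv G L f e 0) = - (\<Sum>e\<in>out_arcs G v0. f' e (L e))"
      unfolding sum_negf[symmetric]
      by (intro sum.cong) (simp_all add: D0 flip_deriv_def inout)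
    moreover have "(\<Sum>e\<in>in_arcs G v0. f' e (L e)) + (\<Sum>e\<in>out_arcs G v0. f' e (L e)) = (\<Sum>e\<in>arcs G. f' e (L e))"
      unfolding inout by (subst sum.union_disjoint[symmetric]) (auto intro!: arg_cong[of _ _ "sum _"])
    ultimately show ?thesis unfolding kirchhoff_def by simp
  qed
  moreover have "kirchhoff G L f (leaf e) \<longleftrightarrow> f' e 0 = 0" if e: "e \<in> arcs G" for e
  proof (cases "head G e = v0")
    case True
    then have "in_arcs G (leaf e) = {}" "out_arcs G (leaf e) = {e}"
      by (intro set_eqI; use e in \<open>simp add: head_eq_leaf tail_eq_leaf cong: conj_cong\<close>; blast)+
    then show ?thesis using True D0[OF e] by (simp add: kirchhoff_def flip_deriv_def)
  next
    case False
    then have "in_arcs G (leaf e) = {e}" "out_arcs G (leaf e) = {}"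
      by (intro set_eqI; use e in \<open>simp add: head_eq_leaf tail_eq_leaf cong: conj_cong\<close>; blast)+
    then show ?thesis using False DL[OF e] by (simp add: kirchhoff_def flip_deriv_def)
  qed
  moreover have "verts G = insert v0 (leaf ` arcs G)"
    using leaf v0 by (auto simp: bij_betw_def)
  ultimately show ?thesis by (simp add: conj_commute)
qed

text \<open>An orientation-free description of the eigenspace. Membership in \<open>H2\<close> is
  contained in the differential equation.\<close>

lemma eigenspace_iff:
  "f \<in> eigenspace G L \<nu> \<longleftrightarrow> (\<forall>z. z \<notin> mg_points G L \<longrightarrow> f z = 0) \<and> mg_continuous G L f \<and>
    (\<exists>f'. (\<forall>e\<in>arcs G. edge_ode \<nu> (L e) (\<lambda>r. f (leaf_pt e r)) (f' e) \<and> f' e 0 = 0) \<and>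
      (\<Sum>e\<in>arcs G. f' e (L e)) = 0)" (is "_ \<longleftrightarrow> ?Z \<and> ?C \<and> ?O")
proof -
  let ?K = "\<forall>v\<in>verts G. kirchhoff G L f v"
  let ?S = "\<forall>e\<in>arcs G. has_L2_deriv2 (L e) (edge_fun G L f e) (\<lambda>s. - (\<nu> * edge_fun G L f e s))"
  have "f \<in> eigenspace G L \<nu> \<longleftrightarrow> ?Z \<and> ?C \<and> ?K \<and> ?S"
    by (auto simp: eigenspace_def neg_laplacian_def laplacian_domain_def H2_def edge_fun_def)
  also have "?S \<longleftrightarrow> (\<forall>e\<in>arcs G. \<exists>d. edge_ode \<nu> (L e) (\<lambda>r. f (leaf_pt e r)) d)"
    by (simp only: has_L2_deriv2_iff_edge_ode edge_ode_leaf_pt_iff)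
  also have "\<dots> \<longleftrightarrow> (\<exists>f'. \<forall>e\<in>arcs G. edge_ode \<nu> (L e) (\<lambda>r. f (leaf_pt e r)) (f' e))"
    by (rule bchoice_iff)
  finally show ?thesis using kirchhoff_iff[of \<nu> f] by blast
qed

lemma eq_on_mg_points:
  assumes "\<And>z. z \<notin> mg_points G L \<Longrightarrow> f z = 0" "\<And>z. z \<notin> mg_points G L \<Longrightarrow> g z = 0"
    "\<And>e r. e \<in> arcs G \<Longrightarrow> r \<in> {0..L e} \<Longrightarrow> f (leaf_pt e r) = g (leaf_pt e r)"
  shows "f = g"
  using assms by (metis ext mg_points_cases)

section \<open>No negative eigenvalues; zero is a simple eigenvalue\<close>

lemma eigenspace_nonpos:
  assumes f: "f \<in> eigenspace G L \<nu>" and \<nu>: "\<nu> \<le> 0" and z: "z \<in> mg_points G L"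
  shows "f z = f (Vertex v0)" "\<nu> * f z = 0"
proof -
  from f obtain f' where ode: "\<And>e. e \<in> arcs G \<Longrightarrow> edge_ode \<nu> (L e) (\<lambda>r. f (leaf_pt e r)) (f' e)"
    and f'0: "\<And>e. e \<in> arcs G \<Longrightarrow> f' e 0 = 0" and sum: "(\<Sum>e\<in>arcs G. f' e (L e)) = 0"
    unfolding eigenspace_iff by blast
  \<comment> \<open>On each edge the product of function and derivative grows from 0 at the leaf, so
    it is nonnegative at \<open>v0\<close>. By the Kirchhoff condition these values add up to zero,
    hence each one vanishes and every edge is rigid.\<close>
  have "f (Vertex v0) * f' e (L e) \<ge> 0" if "e \<in> arcs G" for e
    using edge_ode_nonpos_mono[OF ode \<nu>, of e 0 "L e"] f'0 length_pos that
    by (auto simp: leaf_pt_L less_imp_le)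
  moreover have "(\<Sum>e\<in>arcs G. f (Vertex v0) * f' e (L e)) = 0"
    using sum by (simp add: sum_distrib_left[symmetric])
  ultimately have *: "f (Vertex v0) * f' e (L e) = 0" if "e \<in> arcs G" for e
    using that by (subst (asm) sum_nonneg_eq_0_iff) auto
  have rigid: "f' e r = 0" "\<nu> * f (leaf_pt e r) = 0" if "e \<in> arcs G" "r \<in> {0..L e}" for e r
    using edge_ode_nonpos_rigid[OF ode \<nu> length_pos f'0, of e r] * that
    by (auto simp: leaf_pt_L)
  obtain e r where er: "e \<in> arcs G" "r \<in> {0..L e}" "z = leaf_pt e r" using z by (rule mg_points_cases)
  then show "\<nu> * f z = 0" using rigid by auto
  have "((\<lambda>r. f (leaf_pt e r)) has_real_derivative 0) (at r within {0..L e})" if "r \<in> {0..L e}" for r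
    using edge_odeD(1)[OF ode that] rigid that er by force
  then obtain c where "\<And>r. r \<in> {0..L e} \<Longrightarrow> f (leaf_pt e r) = c"
    using has_field_derivative_zero_constant[of "{0..L e}" "\<lambda>r. f (leaf_pt e r)"] by auto
  from this[of r] this[of "L e"] show "f z = f (Vertex v0)"
    using er by (auto simp: leaf_pt_L)
qed

lemma eigenvalue_nonneg:
  assumes "\<nu> \<in> eigenvalues G L" shows "0 \<le> \<nu>"
proof (rule ccontr)
  assume neg: "\<not> 0 \<le> \<nu>"
  from assms obtain f where f: "f \<in> eigenspace G L \<nu>" "f \<noteq> (\<lambda>x. 0)" by (auto simp: eigenvalues_def)
  have "f z = 0" for z
    using eigenspace_nonpos(2)[OF f(1), of z] neg f(1) by (cases "z \<in> mg_points G L") (auto simp: eigenspace_iff)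
  then show False using f(2) by auto
qed

definition graph_one :: "('v, 'e) mg_point \<Rightarrow> real" where
  "graph_one z = (if z \<in> mg_points G L then 1 else 0)"

lemma graph_one_leaf_pt [simp]: "e \<in> arcs G \<Longrightarrow> r \<in> {0..L e} \<Longrightarrow> graph_one (leaf_pt e r) = 1"
  by (simp add: graph_one_def leaf_pt_in del: atLeastAtMost_iff)

lemma graph_one_in_eigenspace: "graph_one \<in> eigenspace G L 0"
  unfolding eigenspace_iff
proof (intro conjI exI[of _ "\<lambda>e r. 0"] ballI)
  show "mg_continuous G L graph_one"
    by (rule mg_continuous_lipschitz[of _ 1]) auto
  show "edge_ode 0 (L e) (\<lambda>r. graph_one (leaf_pt e r)) (\<lambda>r. 0)" if "e \<in> arcs G" for e
    by (rule edge_ode_cong[of 0 "L e" "\<lambda>r. 1" "\<lambda>r. 0"]) (use that in \<open>auto simp: edge_ode_def\<close>)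
qed (auto simp: graph_one_def)

lemma graph_one_neq_0: "graph_one \<noteq> (\<lambda>z. 0)"
  using v0 by (auto simp: graph_one_def mg_points_def fun_eq_iff intro!: exI[of _ "Vertex v0"])

lemma eigenspace_0_subset: "eigenspace G L 0 \<subseteq> real_fun.span {graph_one}"
proof
  fix f assume f: "f \<in> eigenspace G L 0"
  then have "f z = f (Vertex v0) * graph_one z" for z
    using eigenspace_nonpos(1)[OF f, of z] by (auto simp: graph_one_def eigenspace_iff)
  then have "f = (\<lambda>z. f (Vertex v0) * graph_one z)" by blast
  then show "f \<in> real_fun.span {graph_one}"
    using real_fun.span_scale[OF real_fun.span_base[of graph_one "{graph_one}"], of "f (Vertex v0)"] by auto
qed

lemma zero_eigenvalue: "0 \<in> eigenvalues G L"
  using graph_one_in_eigenspace graph_one_neq_0 by (auto simp: eigenvalues_def)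

lemma eigenvalue_mult_0: "eigenvalue_mult G L 0 = 1"
proof -
  have "eigenvalue_mult G L 0 \<le> card {graph_one}"
    unfolding eigenvalue_mult_def by (rule real_fun.dim_le_card[OF eigenspace_0_subset]) simp
  moreover have "0 < eigenvalue_mult G L 0"
    unfolding eigenvalue_mult_def
    using real_fun.dim_pos[OF eigenspace_0_subset _ graph_one_in_eigenspace] graph_one_neq_0
    by (simp add: zero_fun_def)
  ultimately show ?thesis by simp
qed

section \<open>Positive eigenvalues and their cosine profiles\<close>

lemma eigenspace_posE:
  assumes f: "f \<in> eigenspace G L (k\<^sup>2)" and k: "0 < k"
  obtains a c where "\<forall>e\<in>arcs G. \<forall>r\<in>{0..L e}. f (leaf_pt e r) = a e * cos (k * r)"
    and "\<forall>e\<in>arcs G. a e * cos (k * L e) = c"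
    and "(\<Sum>e\<in>arcs G. a e * sin (k * L e)) = 0"
proof
  from f obtain f' where ode: "\<And>e. e \<in> arcs G \<Longrightarrow> edge_ode (k\<^sup>2) (L e) (\<lambda>r. f (leaf_pt e r)) (f' e)"
    and f'0: "\<And>e. e \<in> arcs G \<Longrightarrow> f' e 0 = 0" and sum: "(\<Sum>e\<in>arcs G. f' e (L e)) = 0"
    unfolding eigenspace_iff by blast
  define a where "a e = f (leaf_pt e 0)" for e
  have k0: "k \<noteq> 0" using k by simp
  have cos: "f (leaf_pt e r) = a e * cos (k * r)" if "e \<in> arcs G" "r \<in> {0..L e}" for e r
    unfolding a_def by (rule edge_ode_cos(1)[OF ode[OF that(1)] k0 f'0[OF that(1)] that(2)])
  then show "\<forall>e\<in>arcs G. \<forall>r\<in>{0..L e}. f (leaf_pt e r) = a e * cos (k * r)" by blast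
  show "\<forall>e\<in>arcs G. a e * cos (k * L e) = f (Vertex v0)"
  proof
    fix e assume "e \<in> arcs G"
    then show "a e * cos (k * L e) = f (Vertex v0)"
      using cos[of e "L e"] length_pos[of e] by (simp add: leaf_pt_L)
  qed
  have "f' e (L e) = - (k * (a e * sin (k * L e)))" if "e \<in> arcs G" for e
    using edge_ode_cos(2)[OF ode[OF that] k0 f'0[OF that], of "L e"] length_pos[OF that]
    by (simp add: a_def)
  with sum show "(\<Sum>e\<in>arcs G. a e * sin (k * L e)) = 0"
    using k0 by (simp add: sum_negf sum_distrib_left[symmetric])
qed

text \<open>Glues the profiles \<open>a e * cos (k * r)\<close>: the common value \<open>c\<close>
  makes them fit at \<open>v0\<close>, their slopes vanish at the leaves, and \<open>sum\<close> is
  the Kirchhoff condition at \<open>v0\<close> up to the factor \<open>- k\<close>. At the leaf of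
  \<open>e1\<close> the function is \<open>a e1\<close>, hence nontrivial.\<close>

lemma eigenvalue_posI:
  assumes c: "\<And>e. e \<in> arcs G \<Longrightarrow> a e * cos (k * L e) = c"
    and sum: "(\<Sum>e\<in>arcs G. a e * sin (k * L e)) = 0"
    and ne: "e1 \<in> arcs G" "a e1 \<noteq> 0"
  shows "k\<^sup>2 \<in> eigenvalues G L"
proof -
  obtain f where "\<forall>e\<in>arcs G. \<forall>r\<in>{0..L e}. f (leaf_pt e r) = a e * cos (k * r)"
    and out: "\<forall>z. z \<notin> mg_points G L \<longrightarrow> f z = 0"
    by (rule glue_function[of "\<lambda>e r. a e * cos (k * r)", OF c])
  note f = this(1)[rule_format]
  \<comment> \<open>The sum dominates the slopes on all edges at once; the summand 1 keeps
    \<open>C\<close> positive even if all of them are zero.\<close>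
  define C where "C = 1 + (\<Sum>e\<in>arcs G. \<bar>a e * k\<bar>)"
  have "0 < C" unfolding C_def by (intro add_pos_nonneg sum_nonneg) auto
  have lip: "\<bar>f (leaf_pt e r) - f (leaf_pt e r')\<bar> \<le> C * \<bar>r - r'\<bar>"
    if e: "e \<in> arcs G" "r \<in> {0..L e}" "r' \<in> {0..L e}" for e r r'
  proof -
    have "\<bar>a e * k\<bar> \<le> C" unfolding C_def using member_le_sum[of e "arcs G" "\<lambda>e. \<bar>a e * k\<bar>"] e by auto
    have "\<bar>f (leaf_pt e r) - f (leaf_pt e r')\<bar> = \<bar>a e\<bar> * \<bar>cos (k * r) - cos (k * r')\<bar>"
      using f e by (simp add: abs_mult[symmetric] right_diff_distrib)
    also have "\<dots> \<le> \<bar>a e\<bar> * \<bar>k * r - k * r'\<bar>"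
      using abs_cos_diff_le by (intro mult_left_mono) auto
    also have "\<dots> = \<bar>a e * k\<bar> * \<bar>r - r'\<bar>"
      by (simp add: abs_mult right_diff_distrib[symmetric])
    also have "\<dots> \<le> C * \<bar>r - r'\<bar>" using \<open>\<bar>a e * k\<bar> \<le> C\<close> by (intro mult_right_mono) auto
    finally show ?thesis .
  qed
  have "f \<in> eigenspace G L (k\<^sup>2)"
    unfolding eigenspace_iff
  proof (intro conjI exI[of _ "\<lambda>e r. - (k * a e * sin (k * r))"] ballI)
    show "mg_continuous G L f" by (rule mg_continuous_lipschitz[OF lip \<open>0 < C\<close>])
    show "edge_ode (k\<^sup>2) (L e) (\<lambda>r. f (leaf_pt e r)) (\<lambda>r. - (k * a e * sin (k * r)))" if "e \<in> arcs G" for e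
      by (rule edge_ode_cong[OF cos_edge_ode[of k _ "a e"]]) (use that f in auto)
    show "(\<Sum>e\<in>arcs G. - (k * a e * sin (k * L e))) = 0"
      using sum by (simp add: sum_negf mult.assoc sum_distrib_left[symmetric])
  qed (use out in auto)
  moreover have "f (leaf_pt e1 0) \<noteq> 0" using f[of e1 0] ne length_pos[of e1] by simp
  ultimately show ?thesis unfolding eigenvalues_def by (intro CollectI bexI[of _ f]) auto
qed

text \<open>An eigenvalue contributes to the count in \<open>mu\<close> only through a positive
  multiplicity, so a finite set spanning the eigenspace has to be exhibited.\<close>

lemma eigenvalue_mult_pos:
  assumes "k\<^sup>2 \<in> eigenvalues G L" "0 < k"
  shows "0 < eigenvalue_mult G L (k\<^sup>2)"
proof -
  \<comment> \<open>\<open>\<phi> e\<close> is the cosine profile on the edge \<open>e\<close> with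
    its end \<open>v0\<close> removed, so that supports are disjoint and the coordinate
    \<open>r\<close> is unique; \<open>\<delta>\<close> carries the value at \<open>v0\<close>.
    These functions need not belong to the eigenspace.\<close>
  define \<phi> where "\<phi> e z = (if \<exists>r\<in>{0..<L e}. z = leaf_pt e r
    then cos (k * (THE r. r \<in> {0..<L e} \<and> z = leaf_pt e r)) else 0)" for e z
  define \<delta> where "\<delta> z = (if z = Vertex v0 then 1 else 0 :: real)" for z :: "('v, 'e) mg_point"
  have phi: "\<phi> e (leaf_pt e' r) = (if e = e' then cos (k * r) else 0)"
    if "e \<in> arcs G" "e' \<in> arcs G" "r \<in> {0..<L e'}" for e e' r
  proof -
    have *: "r' \<in> {0..<L e} \<and> leaf_pt e' r = leaf_pt e r' \<longleftrightarrow> e = e' \<and> r' = r" for r'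
    proof
      assume r': "r' \<in> {0..<L e} \<and> leaf_pt e' r = leaf_pt e r'"
      then have "e' = e \<and> r = r' \<or> r = L e' \<and> r' = L e"
        using that by (intro leaf_pt_eqD) auto
      then show "e = e' \<and> r' = r" using r' by auto
    qed (use that in auto)
    show ?thesis
    proof (cases "e = e'")
      case True
      then show ?thesis unfolding \<phi>_def Bex_def * by simp
    next
      case False
      then show ?thesis unfolding \<phi>_def Bex_def * by simp
    qed
  qed
  have phi0: "\<phi> e (Vertex v0) = 0" if "e \<in> arcs G" for e
  proof -
    have "Vertex v0 \<noteq> leaf_pt e r" if "r \<in> {0..<L e}" for r
      using leaf_pt_eqD[of e "L e" e r] \<open>e \<in> arcs G\<close> that by (simp add: leaf_pt_L) blast
    then show ?thesis by (simp add: \<phi>_def)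
  qed
  have "eigenspace G L (k\<^sup>2) \<subseteq> real_fun.span (insert \<delta> (\<phi> ` arcs G))"
  proof
    fix f assume f: "f \<in> eigenspace G L (k\<^sup>2)"
    obtain a where "\<forall>e\<in>arcs G. \<forall>r\<in>{0..L e}. f (leaf_pt e r) = a e * cos (k * r)"
      by (rule eigenspace_posE[OF f assms(2)])
    note a = this[rule_format]
    let ?g = "(\<lambda>z. f (Vertex v0) * \<delta> z) + (\<Sum>e\<in>arcs G. (\<lambda>z. a e * \<phi> e z))"
    have sum_app: "(\<Sum>e\<in>A. h e) z = (\<Sum>e\<in>A. h e z)" if "finite A"
      for h :: "'e \<Rightarrow> ('v, 'e) mg_point \<Rightarrow> real" and A z
      using that by (induction A) auto
    have "f = ?g"
    proof (rule eq_on_mg_points)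
      fix z assume z: "z \<notin> mg_points G L"
      then show "f z = 0" using f by (simp add: eigenspace_iff)
      have "\<phi> e z = 0" if "e \<in> arcs G" for e
        using z leaf_pt_in[OF that] by (auto simp: \<phi>_def)
      then show "?g z = 0" using z v0 by (auto simp: \<delta>_def sum_app mg_points_def)
    next
      fix e r assume e: "e \<in> arcs G" and r: "r \<in> {0..L e}"
      show "f (leaf_pt e r) = ?g (leaf_pt e r)"
      proof (cases "r = L e")
        case True
        then show ?thesis using e phi0 by (simp add: leaf_pt_L sum_app \<delta>_def)
      next
        case False
        then have r': "r \<in> {0..<L e}" using r by auto
        then have "leaf_pt e r \<noteq> Vertex v0"
          using leaf_pt_eqD[of e "L e" e r] e length_pos[OF e] by (auto simp: leaf_pt_L)
        moreover have "(\<Sum>e'\<in>arcs G. a e' * \<phi> e' (leaf_pt e r)) = (\<Sum>e'\<in>arcs G. if e' = e then a e * cos (k * r) else 0)"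
          using phi[OF _ e r'] by (intro sum.cong) auto
        ultimately show ?thesis using a[OF e r] e by (simp add: sum_app \<delta>_def)
      qed
    qed
    also have "?g \<in> real_fun.span (insert \<delta> (\<phi> ` arcs G))"
      by (intro real_fun.span_add real_fun.span_sum real_fun.span_scale real_fun.span_base) auto
    finally show "f \<in> real_fun.span (insert \<delta> (\<phi> ` arcs G))" .
  qed
  moreover obtain f where "f \<in> eigenspace G L (k\<^sup>2)" "f \<noteq> (\<lambda>x. 0)"
    using assms by (auto simp: eigenvalues_def)
  ultimately show ?thesis
    unfolding eigenvalue_mult_def
    by (intro real_fun.dim_pos[of _ "insert \<delta> (\<phi> ` arcs G)" f]) (auto simp: zero_fun_def)
qed

section \<open>From nontrivial amplitudes to bounds for the second eigenvalue\<close>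

lemma eigenfunction_nonzero:
  assumes "f \<in> eigenspace G L \<nu>" "f \<noteq> (\<lambda>z. 0)"
    and "\<And>e r. e \<in> arcs G \<Longrightarrow> r \<in> {0..L e} \<Longrightarrow> f (leaf_pt e r) = a e * cos (k * r)"
  shows "\<exists>e\<in>arcs G. a e \<noteq> 0"
proof (rule ccontr)
  assume *: "\<not> (\<exists>e\<in>arcs G. a e \<noteq> 0)"
  have "f = (\<lambda>z. 0)"
    by (rule eq_on_mg_points) (use assms * in \<open>auto simp: eigenspace_iff\<close>)
  with assms(2) show False by contradiction
qed

text \<open>All cosines at \<open>v0\<close> are positive, so \<open>a e = c / cos (k * L e)\<close>
  and the Kirchhoff condition reads \<open>c\<close> times a sum of positive tangents equals zero.
  Hence \<open>c\<close> and then all amplitudes vanish.\<close>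

lemma no_small_eigenvalue:
  assumes k: "0 < k" and small: "\<And>e. e \<in> arcs G \<Longrightarrow> k * L e < pi / 2"
  shows "k\<^sup>2 \<notin> eigenvalues G L"
proof
  assume "k\<^sup>2 \<in> eigenvalues G L"
  then obtain f where f: "f \<in> eigenspace G L (k\<^sup>2)" "f \<noteq> (\<lambda>z. 0)" by (auto simp: eigenvalues_def)
  obtain a c where "\<forall>e\<in>arcs G. \<forall>r\<in>{0..L e}. f (leaf_pt e r) = a e * cos (k * r)"
    and "\<forall>e\<in>arcs G. a e * cos (k * L e) = c" and sum: "(\<Sum>e\<in>arcs G. a e * sin (k * L e)) = 0"
    by (rule eigenspace_posE[OF f(1) k])
  note a = this(1)[rule_format] and c = this(2)[rule_format]
  have pos: "0 < k * L e" "0 < cos (k * L e)" "0 < tan (k * L e)" if "e \<in> arcs G" for e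
    using small[OF that] k length_pos[OF that] by (auto intro!: cos_gt_zero tan_gt_zero)
  have "a e * sin (k * L e) = c * tan (k * L e)" if "e \<in> arcs G" for e
    using c[OF that, symmetric] pos[OF that] by (simp add: tan_def)
  then have "c * (\<Sum>e\<in>arcs G. tan (k * L e)) = 0"
    using sum by (simp add: sum_distrib_left)
  moreover have "0 < (\<Sum>e\<in>arcs G. tan (k * L e))"
    using pos nonempty by (intro sum_pos) auto
  ultimately have "c = 0" by simp
  then have "a e = 0" if "e \<in> arcs G" for e using c[OF that] pos[OF that] by simp
  then show False using eigenfunction_nonzero[OF f a] by auto
qed

text \<open>Below the first bound the only eigenvalue is 0, whose multiplicity one cannot reach the
  count 2; the pair \<open>{0, k0\<^sup>2}\<close> does reach it.\<close>

lemma mu_2_bounds: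
  assumes e1: "e1 \<in> arcs G" and max: "\<And>e. e \<in> arcs G \<Longrightarrow> L e \<le> L e1"
    and k0: "0 < k0" "k0\<^sup>2 \<in> eigenvalues G L"
  shows "(pi / (2 * L e1))\<^sup>2 \<le> mu G L 2" "mu G L 2 \<le> k0\<^sup>2"
proof -
  define S where "S = {r. \<exists>F. finite F \<and> F \<subseteq> eigenvalues G L \<inter> {..r} \<and>
    2 \<le> (\<Sum>\<nu>\<in>F. eigenvalue_mult G L \<nu>)}"
  have mu: "mu G L 2 = Inf S" by (simp add: mu_def S_def)
  have L1: "0 < L e1" by (rule length_pos[OF e1])
  have gap: "\<nu> = 0 \<or> (pi / (2 * L e1))\<^sup>2 \<le> \<nu>" if \<nu>: "\<nu> \<in> eigenvalues G L" for \<nu>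
  proof (rule ccontr)
    assume *: "\<not> (\<nu> = 0 \<or> (pi / (2 * L e1))\<^sup>2 \<le> \<nu>)"
    then have pos: "0 < \<nu>" using eigenvalue_nonneg[OF \<nu>] by auto
    have "sqrt \<nu> < pi / (2 * L e1)" using * L1 by (intro real_less_lsqrt) auto
    then have k1: "sqrt \<nu> * L e1 < pi / 2" using L1 by (simp add: field_simps)
    have "sqrt \<nu> * L e < pi / 2" if "e \<in> arcs G" for e
    proof -
      have "sqrt \<nu> * L e \<le> sqrt \<nu> * L e1" using max[OF that] pos by (intro mult_left_mono) auto
      then show ?thesis using k1 by linarith
    qed
    then have "(sqrt \<nu>)\<^sup>2 \<notin> eigenvalues G L"
      using pos by (intro no_small_eigenvalue) auto
    then show False using \<nu> pos by simp
  qed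
  have lower: "(pi / (2 * L e1))\<^sup>2 \<le> r" if rS: "r \<in> S" for r
  proof (rule ccontr)
    assume r: "\<not> (pi / (2 * L e1))\<^sup>2 \<le> r"
    obtain F where F: "finite F" "F \<subseteq> eigenvalues G L \<inter> {..r}"
      "2 \<le> (\<Sum>\<nu>\<in>F. eigenvalue_mult G L \<nu>)" using rS unfolding S_def by blast
    have "F \<subseteq> {0}" using F(2) gap r by force
    then have "(\<Sum>\<nu>\<in>F. eigenvalue_mult G L \<nu>) \<le> (\<Sum>\<nu>\<in>{0}. eigenvalue_mult G L \<nu>)"
      by (intro sum_mono2) auto
    then show False using F(3) by (simp add: eigenvalue_mult_0)
  qed
  have "k0\<^sup>2 \<in> S"
    unfolding S_def using k0 zero_eigenvalue eigenvalue_mult_pos[OF k0(2,1)]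
    by (intro CollectI exI[of _ "{0, k0\<^sup>2}"]) (auto simp: eigenvalue_mult_0)
  then show "(pi / (2 * L e1))\<^sup>2 \<le> mu G L 2" "mu G L 2 \<le> k0\<^sup>2"
    unfolding mu using lower by (auto intro!: cInf_greatest cInf_lower bdd_belowI)
qed

section \<open>Exact distances between points of a star\<close>

lemma mg_dist_two_edges:
  assumes e: "e \<in> arcs G" "r \<in> {0..L e}" and e': "e' \<in> arcs G" "r' \<in> {0..L e'}" and ne: "e \<noteq> e'"
  shows "mg_dist G L (leaf_pt e r) (leaf_pt e' r') = (L e - r) + (L e' - r')"
proof (rule antisym)
  show "mg_dist G L (leaf_pt e r) (leaf_pt e' r') \<le> (L e - r) + (L e' - r')"
    by (rule mg_dist_le[OF mg_path_two_edges[OF e e']])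
  \<comment> \<open>Test function: the signed distance to \<open>v0\<close>, positive on
    \<open>e\<close> and negative on all other edges. It has Lipschitz constant 1, and its two
    values differ by the claimed distance.\<close>
  obtain f where "\<forall>e''\<in>arcs G. \<forall>s\<in>{0..L e''}.
      f (leaf_pt e'' s) = (if e'' = e then L e'' - s else s - L e'')"
    by (rule glue_function[of "\<lambda>e'' s. if e'' = e then L e'' - s else s - L e''" 0]) auto
  note f = this[rule_format]
  have "\<bar>f (leaf_pt e r) - f (leaf_pt e' r')\<bar> \<le> 1 * mg_dist G L (leaf_pt e r) (leaf_pt e' r')"
    by (rule mg_dist_lipschitz[OF leaf_pt_in[OF e] leaf_pt_in[OF e']]) (auto simp: f)
  then show "(L e - r) + (L e' - r') \<le> mg_dist G L (leaf_pt e r) (leaf_pt e' r')"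
    using f[OF e] f[OF e'] ne by auto
qed

lemma mg_dist_same_edge:
  assumes e: "e \<in> arcs G" "r \<in> {0..L e}" "r' \<in> {0..L e}"
  shows "mg_dist G L (leaf_pt e r) (leaf_pt e r') = \<bar>r - r'\<bar>"
proof (rule antisym)
  show "mg_dist G L (leaf_pt e r) (leaf_pt e r') \<le> \<bar>r - r'\<bar>"
    by (rule mg_dist_le[OF mg_path_same_edge[OF e]])
  obtain f where "\<forall>e\<in>arcs G. \<forall>s\<in>{0..L e}. f (leaf_pt e s) = L e - s"
    by (rule glue_function[of "\<lambda>e s. L e - s" 0]) auto
  note f = this[rule_format]
  have "\<bar>f (leaf_pt e r) - f (leaf_pt e r')\<bar> \<le> 1 * mg_dist G L (leaf_pt e r) (leaf_pt e r')"
    by (rule mg_dist_lipschitz[OF leaf_pt_in[OF e(1,2)] leaf_pt_in[OF e(1,3)]]) (auto simp: f)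
  then show "\<bar>r - r'\<bar> \<le> mg_dist G L (leaf_pt e r) (leaf_pt e r')"
    using f[OF e(1,2)] f[OF e(1,3)] by auto
qed

end

section \<open>The second eigenvalue\<close>

text \<open>\<open>l2\<close> is a number rather than the length of a chosen edge, so that a single
  edge fits in with \<open>l2 = 0\<close>. If several edges are longest, then
  \<open>l2 = L e1\<close>.\<close>

locale star_two_longest = star_metric_graph G L v0 leaf
  for G :: "('v, 'e) pre_digraph" and L v0 leaf +
  fixes e1 :: 'e and l2 :: real
  assumes e1: "e1 \<in> arcs G"
    and le_L1: "e \<in> arcs G \<Longrightarrow> L e \<le> L e1"
    and le_l2: "e \<in> arcs G \<Longrightarrow> e \<noteq> e1 \<Longrightarrow> L e \<le> l2"
    and l2_cases: "arcs G = {e1} \<and> l2 = 0 \<or> (\<exists>e2\<in>arcs G. e2 \<noteq> e1 \<and> L e2 = l2)"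
begin

lemma L1_pos: "0 < L e1"
  by (rule length_pos[OF e1])

lemma l2_le: "l2 \<le> L e1" and l2_nonneg: "0 \<le> l2"
  using l2_cases L1_pos le_L1 length_pos by fastforce+

text \<open>No distance exceeds the sum of the two largest lengths, so a pair attaining this sum
  turns the supremum into a maximum.\<close>

lemma mg_diam_eqI:
  assumes x: "x \<in> mg_points G L" and y: "y \<in> mg_points G L" and d: "mg_dist G L x y = L e1 + l2"
  shows "mg_dist G L x y = mg_diam G L"
proof -
  have "mg_dist G L u v \<le> L e1 + l2" if u: "u \<in> mg_points G L" and v: "v \<in> mg_points G L" for u v
  proof -
    obtain e r where e: "e \<in> arcs G" "r \<in> {0..L e}" "u = leaf_pt e r"
      using u by (rule mg_points_cases)
    obtain e' r' where e': "e' \<in> arcs G" "r' \<in> {0..L e'}" "v = leaf_pt e' r'"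
      using v by (rule mg_points_cases)
    show ?thesis
    proof (cases "e = e'")
      case True
      then show ?thesis
        using mg_dist_same_edge[of e r r'] e e' le_L1[of e] l2_nonneg by auto
    next
      case False
      have "L e + L e' \<le> L e1 + l2"
        using False e e' le_L1[of e'] le_l2[of e] le_l2[of e'] by (cases "e = e1") auto
      then show ?thesis using mg_dist_two_edges[of e r e' r'] e e' False by auto
    qed
  qed
  then have "mg_diam G L = L e1 + l2"
    unfolding mg_diam_def using x y d[symmetric] by (intro cSup_eq_maximum) auto
  with d show ?thesis by simp
qed

text \<open>On \<open>[pi / (2 l\<^sub>1), pi / (l\<^sub>1 + l\<^sub>2)]\<close> only the longest edge has a nonpositive cosine, and
  multiplying the secular equation by it removes the pole at the left end. At the right end the
  two longest edges cancel, because \<open>k l\<^sub>1 + k l\<^sub>2 = pi\<close>.\<close>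

lemma secular_eigenvalue: "\<exists>k>0. k \<le> pi / (L e1 + l2) \<and> k\<^sup>2 \<in> eigenvalues G L"
proof (cases "l2 = L e1")
  case True
  then obtain e2 where e2: "e2 \<in> arcs G" "e2 \<noteq> e1" "L e2 = L e1"
    using l2_cases L1_pos by auto
  define k where "k = pi / (2 * L e1)"
  \<comment> \<open>The cosines of both longest edges vanish at \<open>v0\<close>, so opposite
    amplitudes there and zero elsewhere satisfy all conditions with \<open>c = 0\<close>.\<close>
  define a where "a e = (if e = e1 then 1 else if e = e2 then -1 else 0 :: real)" for e
  have "k * L e1 = pi / 2" using L1_pos by (simp add: k_def)
  then have k: "cos (k * L e1) = 0" by (simp only: cos_pi_half)
  have "(\<Sum>e\<in>arcs G. a e * sin (k * L e)) = (\<Sum>e\<in>{e1, e2}. a e * sin (k * L e))"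
    using e1 e2 by (intro sum.mono_neutral_right) (auto simp: a_def)
  also have "\<dots> = 0" using e2 by (simp add: a_def)
  finally have "k\<^sup>2 \<in> eigenvalues G L"
    using e1 e2 k by (intro eigenvalue_posI[of a k 0 e1]) (auto simp: a_def)
  moreover have "0 < k" using L1_pos by (simp add: k_def)
  moreover have "k \<le> pi / (L e1 + l2)" using True by (simp add: k_def)
  ultimately show ?thesis by blast
next
  case False
  then have lt: "l2 < L e1" using l2_le by simp
  define p q where "p = pi / (2 * L e1)" and "q = pi / (L e1 + l2)"
  define h where "h k = cos (k * L e1) * (\<Sum>e\<in>arcs G - {e1}. tan (k * L e)) + sin (k * L e1)" for k
  have p: "0 < p" using L1_pos by (simp add: p_def)
  have pq: "p \<le> q" unfolding p_def q_def using L1_pos l2_nonneg lt by (intro divide_left_mono) auto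
  have "q * (L e1 + l2) = pi" using L1_pos l2_nonneg by (simp add: q_def)
  then have q: "q * L e1 + q * l2 = pi" by (simp only: distrib_left)
  have q0: "0 < q" using p pq by simp
  have ql2: "q * l2 < pi / 2" using mult_strict_left_mono[OF lt q0] q by linarith
  have small: "0 < k * L e" "k * L e < pi / 2" if "k \<in> {p..q}" "e \<in> arcs G - {e1}" for k e
  proof -
    have L: "0 < L e" "L e \<le> l2" using that length_pos le_l2 by auto
    then show "0 < k * L e" using that p by auto
    have "k * L e \<le> q * l2" using that L q0 by (intro mult_mono) auto
    then show "k * L e < pi / 2" using ql2 by simp
  qed
  have "continuous_on {p..q} h"
    unfolding h_def
  proof (intro continuous_intros ballI)
    fix e k assume "e \<in> arcs G - {e1}" "k \<in> {p..q}"
    then show "cos (k * L e) \<noteq> 0" using small[of k e] cos_gt_zero[of "k * L e"] by auto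
  qed
  moreover have "p * L e1 = pi / 2" using L1_pos by (simp add: p_def)
  then have "0 \<le> h p" by (simp only: h_def cos_pi_half sin_pi_half)
  moreover have "h q \<le> 0"
    using l2_cases
  proof
    assume "arcs G = {e1} \<and> l2 = 0"
    then show ?thesis using q by (simp add: h_def)
  next
    assume "\<exists>e2\<in>arcs G. e2 \<noteq> e1 \<and> L e2 = l2"
    then obtain e2 where e2: "e2 \<in> arcs G - {e1}" "L e2 = l2" by auto
    define R where "R = (\<Sum>e\<in>arcs G - {e1} - {e2}. tan (q * L e))"
    have qp: "q \<in> {p..q}" using pq by simp
    have "0 \<le> R" unfolding R_def using small[OF qp]
      by (intro sum_nonneg) (auto intro!: less_imp_le tan_gt_zero)
    have cos: "0 < cos (q * l2)" using small[OF qp e2(1)] e2(2) by (auto intro: cos_gt_zero)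
    have "q * L e1 = pi - q * l2" using q by simp
    then have "h q = - cos (q * l2) * (tan (q * l2) + R) + sin (q * l2)"
      unfolding h_def R_def using e2 by (subst sum.remove[of _ e2]) simp_all
    also have "\<dots> = - (cos (q * l2) * R)" using cos by (simp add: tan_def field_simps)
    finally show ?thesis using cos \<open>0 \<le> R\<close> by simp
  qed
  ultimately obtain k where k: "p \<le> k" "k \<le> q" "h k = 0"
    using IVT2'[of h q 0 p] pq by auto
  \<comment> \<open>With amplitude 1 on \<open>e1\<close>, continuity at \<open>v0\<close> dictates
    the others, and the Kirchhoff sum becomes \<open>h k\<close>.\<close>
  define a where "a e = (if e = e1 then 1 else cos (k * L e1) / cos (k * L e))" for e
  have cos: "cos (k * L e) \<noteq> 0" if "e \<in> arcs G - {e1}" for e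
    using small[of k e] k that cos_gt_zero[of "k * L e"] by auto
  have "(\<Sum>e\<in>arcs G. a e * sin (k * L e)) = h k"
    using e1 by (subst sum.remove[of _ e1]) (auto simp: a_def h_def tan_def sum_distrib_left intro!: sum.cong)
  then have "k\<^sup>2 \<in> eigenvalues G L"
    using k e1 cos by (intro eigenvalue_posI[of a k "cos (k * L e1)" e1]) (auto simp: a_def)
  then show ?thesis using k p by (intro exI[of _ k]) (auto simp: q_def)
qed

text \<open>Only \<open>e1\<close> can have a nonpositive cosine at \<open>v0\<close>, so all other
  amplitudes are positive and the Kirchhoff condition forces \<open>a e1 < 0\<close>. The minimum
  therefore sits at the leaf of \<open>e1\<close>. Elsewhere \<open>a e = c / cos (k * L e)\<close>
  grows with the length, which puts the maximum at the leaf of a second longest edge; for a single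
  edge \<open>v0\<close> takes that role.\<close>

lemma extrema_strict:
  assumes lt: "l2 < L e1" and k: "0 < k" "pi / 2 \<le> k * L e1" "k * L e1 + k * l2 \<le> pi"
    and f: "\<And>e r. e \<in> arcs G \<Longrightarrow> r \<in> {0..L e} \<Longrightarrow> f (leaf_pt e r) = a e * cos (k * r)"
    and c: "\<And>e. e \<in> arcs G \<Longrightarrow> a e * cos (k * L e) = c" "0 < c"
    and sum: "(\<Sum>e\<in>arcs G. a e * sin (k * L e)) = 0"
    and x: "x \<in> mg_points G L" "\<And>z. z \<in> mg_points G L \<Longrightarrow> f z \<le> f x"
    and y: "y \<in> mg_points G L" "\<And>z. z \<in> mg_points G L \<Longrightarrow> f y \<le> f z"
  shows "y = leaf_pt e1 0" "arcs G = {e1} \<and> x = leaf_pt e1 (L e1) \<or>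
    (\<exists>e\<in>arcs G. e \<noteq> e1 \<and> L e = l2 \<and> x = leaf_pt e 0)"
proof -
  have kl2: "k * l2 < pi / 2" using mult_strict_left_mono[OF lt k(1)] k(3) by linarith
  then have kl2_pi: "k * l2 \<le> pi" using pi_gt_zero by linarith
  have kL1: "k * L e1 \<le> pi" using k l2_nonneg mult_nonneg_nonneg[of k l2] by linarith
  have small: "k * r \<in> {0..<pi / 2}" "0 < cos (k * r)" if "e \<in> arcs G" "e \<noteq> e1" "r \<in> {0..L e}" for e r
  proof -
    have "k * r \<le> k * l2" using that k le_l2[of e] by (intro mult_left_mono) auto
    then have "k * r < pi / 2" using kl2 by linarith
    then show "k * r \<in> {0..<pi / 2}" using that k by simp
    then show "0 < cos (k * r)" by (intro cos_gt_zero_pi) auto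
  qed
  have a_pos: "0 < a e" if "e \<in> arcs G" "e \<noteq> e1" for e
    using c(1)[OF that(1)] c(2) small(2)[OF that, of "L e"] length_pos[OF that(1)]
      zero_less_mult_pos2[of "a e" "cos (k * L e)"] by auto
  have single: "k * L e1 = pi \<and> c = - a e1" if "arcs G = {e1}"
  proof -
    have "a e1 \<noteq> 0" using c(1)[OF e1] c(2) by auto
    then have "sin (k * L e1) = 0" using sum that by simp
    then have "k * L e1 = pi" using sin_gt_zero[of "k * L e1"] kL1 k L1_pos by force
    then show ?thesis using c(1)[OF e1] by simp
  qed
  have a1: "a e1 < 0"
  proof (cases "arcs G = {e1}")
    case True
    then show ?thesis using single c by simp
  next
    case False
    then obtain e2 where e2: "e2 \<in> arcs G - {e1}" using e1 by blast
    then have "0 < l2" using le_l2[of e2] length_pos[of e2] by auto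
    \<comment> \<open>The inequality is strict because a second edge has positive length; this makes
      the sine factor of \<open>a e1\<close> nonzero.\<close>
    then have "k * L e1 < pi" using k mult_pos_pos[of k l2] by linarith
    then have sin: "0 < sin (k * L e1)" using k L1_pos by (intro sin_gt_zero) auto
    have "0 < a e * sin (k * L e)" if "e \<in> arcs G - {e1}" for e
    proof -
      have e: "e \<in> arcs G" "e \<noteq> e1" using that by auto
      have "0 < sin (k * L e)"
        using small(1)[OF e, of "L e"] k length_pos[OF e(1)] by (intro sin_gt_zero2) auto
      then show ?thesis using a_pos[OF e] by simp
    qed
    then have "0 < (\<Sum>e\<in>arcs G - {e1}. a e * sin (k * L e))"
      using e2 by (intro sum_pos) auto
    then have "a e1 * sin (k * L e1) < 0"
      using sum e1 by (subst (asm) sum.remove[of _ e1]) auto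
    then show ?thesis using sin by (simp add: mult_less_0_iff)
  qed
  have f_leaf: "f (leaf_pt e 0) = a e" if "e \<in> arcs G" for e
    using f[OF that, of 0] length_pos[OF that] by simp
  have leaf_mem: "leaf_pt e 0 \<in> mg_points G L" if "e \<in> arcs G" for e
    using leaf_pt_in[OF that, of 0] length_pos[OF that] by simp
  have cos_lt_1: "cos (k * r) < 1" if "0 < r" "k * r \<le> pi" for r
    using cos_monotone_0_pi[of 0 "k * r"] that k by simp
  have k_le: "k * r \<le> k * L e1" if "e \<in> arcs G" "r \<in> {0..L e}" for e r
    using le_L1[OF that(1)] that k by (intro mult_left_mono) auto
  show "y = leaf_pt e1 0"
  proof -
    obtain e r where er: "e \<in> arcs G" "r \<in> {0..L e}" "y = leaf_pt e r"
      using y(1) by (rule mg_points_cases)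
    have le: "a e * cos (k * r) \<le> a e1"
      using y(2)[OF leaf_mem[OF e1]] f[OF er(1,2)] f_leaf[OF e1] er(3) by simp
    have "e = e1"
    proof (rule ccontr)
      assume "e \<noteq> e1"
      then show False
        using mult_pos_pos[OF a_pos small(2)[OF _ _ er(2)]] er(1) le a1 by fastforce
    qed
    moreover have "\<not> 0 < r"
    proof
      assume "0 < r"
      then have "cos (k * r) < 1" using k_le[OF er(1,2)] kL1 by (intro cos_lt_1) auto
      then have "a e1 * 1 < a e1 * cos (k * r)" using a1 by (intro mult_strict_left_mono_neg) auto
      then show False using le \<open>e = e1\<close> by simp
    qed
    ultimately show ?thesis using er by auto
  qed
  obtain e r where er: "e \<in> arcs G" "r \<in> {0..L e}" "x = leaf_pt e r"
    using x(1) by (rule mg_points_cases)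
  show "arcs G = {e1} \<and> x = leaf_pt e1 (L e1) \<or> (\<exists>e\<in>arcs G. e \<noteq> e1 \<and> L e = l2 \<and> x = leaf_pt e 0)"
  proof (cases "arcs G = {e1}")
    case True
    then have [simp]: "e = e1" using er by auto
    have "c \<le> a e1 * cos (k * r)"
      using x(2)[of "leaf_pt e1 (L e1)"] leaf_pt_in[OF e1, of "L e1"] f[OF e1, of "L e1"] c(1)[OF e1]
        f[OF er(1,2)] er(3) L1_pos by simp
    then have le: "a e1 * (-1) \<le> a e1 * cos (k * r)" using single[OF True] by simp
    have "\<not> r < L e1"
    proof
      assume "r < L e1"
      then have "k * r < pi" using single[OF True] mult_strict_left_mono[of r "L e1" k] k by simp
      then have "-1 < cos (k * r)" using cos_monotone_0_pi[of "k * r" pi] er(2) k by simp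
      then have "a e1 * cos (k * r) < a e1 * (-1)" using a1 by (intro mult_strict_left_mono_neg) auto
      then show False using le by simp
    qed
    then show ?thesis using True er by auto
  next
    case False
    then obtain e2 where e2: "e2 \<in> arcs G" "e2 \<noteq> e1" "L e2 = l2" using l2_cases by auto
    have l2: "0 < l2" using length_pos[OF e2(1)] e2(3) by simp
    have le: "a e2 \<le> a e * cos (k * r)"
      using x(2)[OF leaf_mem[OF e2(1)]] f_leaf[OF e2(1)] f[OF er(1,2)] er(3) by simp
    have c2: "a e2 * cos (k * l2) = c" using c(1)[OF e2(1)] e2 by simp
    have cos2: "0 < cos (k * l2)" using small(2)[OF e2(1,2), of l2] e2(3) l2 by simp
    \<comment> \<open>On \<open>e1\<close> the function increases towards \<open>v0\<close>, where
      its value \<open>c\<close> is still below the leaf value \<open>a e2\<close>.\<close>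
    have "e \<noteq> e1"
    proof
      assume [simp]: "e = e1"
      have "cos (k * L e1) \<le> cos (k * r)"
        using k_le[OF er(1,2)] kL1 er(2) k by (intro cos_monotone_0_pi_le) auto
      then have "a e1 * cos (k * r) \<le> a e1 * cos (k * L e1)" using a1 by (intro mult_left_mono_neg) auto
      also have "\<dots> = a e2 * cos (k * l2)" using c(1)[OF e1] c2 by simp
      also have "\<dots> < a e2 * 1"
        using a_pos[OF e2(1,2)] kl2 pi_gt_zero by (intro mult_strict_left_mono cos_lt_1[OF l2]) linarith+
      finally show False using le by simp
    qed
    have cosL: "cos (k * l2) \<le> cos (k * L e)"
      using le_l2[OF er(1) \<open>e \<noteq> e1\<close>] k kl2_pi length_pos[OF er(1)]
      by (intro cos_monotone_0_pi_le) auto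
    have ae: "a e \<le> a e2"
    proof -
      have "a e * cos (k * l2) \<le> a e * cos (k * L e)"
        using cosL a_pos[OF er(1) \<open>e \<noteq> e1\<close>] by (intro mult_left_mono) auto
      then have "a e * cos (k * l2) \<le> a e2 * cos (k * l2)" using c(1)[OF er(1)] c2 by simp
      then show ?thesis using cos2 by simp
    qed
    have "\<not> 0 < r"
    proof
      assume "0 < r"
      then have "cos (k * r) < 1" using k_le[OF er(1,2)] kL1 by (intro cos_lt_1) auto
      then have "a e * cos (k * r) < a e * 1"
        using a_pos[OF er(1) \<open>e \<noteq> e1\<close>] by (intro mult_strict_left_mono) auto
      then show False using le ae by simp
    qed
    then have r: "r = 0" using er(2) by simp
    then have "a e = a e2" using le ae by simp
    \<comment> \<open>Equal amplitudes and the common value at \<open>v0\<close> give equal cosines;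
      strict monotonicity of the cosine then fixes the length of \<open>e\<close>.\<close>
    then have "cos (k * L e) = cos (k * l2)"
      using c(1)[OF er(1)] c2 a_pos[OF e2(1,2)] by (metis mult_cancel_left less_irrefl)
    have "\<not> L e < l2"
    proof
      assume "L e < l2"
      then have "k * L e < k * l2" using k by simp
      then have "cos (k * l2) < cos (k * L e)"
        using kl2_pi k length_pos[OF er(1)] by (intro cos_monotone_0_pi) auto
      then show False using \<open>cos (k * L e) = cos (k * l2)\<close> by simp
    qed
    then show ?thesis using le_l2[OF er(1) \<open>e \<noteq> e1\<close>] er r \<open>e \<noteq> e1\<close> by force
  qed
qed

text \<open>Edges shorter than \<open>L e1\<close> have a positive cosine at \<open>v0\<close>, so
  they carry the zero function. On the longest edges the sine at \<open>v0\<close> is 1, so the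
  amplitudes add up to zero and, not all being zero, one is positive. Applied to an eigenfunction
  and its negative, this locates both extrema.\<close>

lemma maximum_balanced:
  assumes k: "0 < k" "k * L e1 = pi / 2"
    and f: "\<And>e r. e \<in> arcs G \<Longrightarrow> r \<in> {0..L e} \<Longrightarrow> f (leaf_pt e r) = a e * cos (k * r)"
    and c: "\<And>e. e \<in> arcs G \<Longrightarrow> a e * cos (k * L e) = 0"
    and sum: "(\<Sum>e\<in>arcs G. a e * sin (k * L e)) = 0" and ne: "\<exists>e\<in>arcs G. a e \<noteq> 0"
    and x: "x \<in> mg_points G L" "\<And>z. z \<in> mg_points G L \<Longrightarrow> f z \<le> f x"
  shows "\<exists>e\<in>arcs G. L e = L e1 \<and> 0 < a e \<and> x = leaf_pt e 0"
proof -
  have k_le: "k * r \<in> {0..pi / 2}" if "e \<in> arcs G" "r \<in> {0..L e}" for e r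
  proof -
    have "k * r \<le> k * L e1" using le_L1[OF that(1)] that k by (intro mult_left_mono) auto
    then show ?thesis using that k by auto
  qed
  have full: "L e = L e1" if "e \<in> arcs G" "a e \<noteq> 0" for e
  proof (rule ccontr)
    assume "L e \<noteq> L e1"
    then have "L e < L e1" using le_L1[OF that(1)] by simp
    then have "k * L e < pi / 2" using mult_strict_left_mono[of "L e" "L e1" k] k by simp
    then have "0 < cos (k * L e)" using length_pos[OF that(1)] k by (intro cos_gt_zero) auto
    then show False using c[OF that(1)] that(2) by simp
  qed
  have "a e * sin (k * L e) = a e" if "e \<in> arcs G" for e
  proof (cases "a e = 0")
    case False
    then have "k * L e = pi / 2" using full[OF that] k(2) by simp
    then show ?thesis by (simp only: sin_pi_half mult_1_right)
  qed simp
  then have sum_a: "(\<Sum>e\<in>arcs G. a e) = 0"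
    using sum sum.cong[of "arcs G" "arcs G" "\<lambda>e. a e * sin (k * L e)" a] by simp
  obtain e' where e': "e' \<in> arcs G" "0 < a e'"
  proof (rule ccontr)
    assume "\<not> thesis"
    then have "\<forall>e\<in>arcs G. 0 \<le> - a e" using that by force
    then have "\<forall>e\<in>arcs G. - a e = 0"
      using sum_a by (subst sum_nonneg_eq_0_iff[symmetric]) (auto simp: sum_negf)
    then show False using ne by auto
  qed
  obtain e r where er: "e \<in> arcs G" "r \<in> {0..L e}" "x = leaf_pt e r"
    using x(1) by (rule mg_points_cases)
  have le: "a u \<le> a e * cos (k * r)" if "u \<in> arcs G" for u
    using x(2)[of "leaf_pt u 0"] leaf_pt_in[OF that, of 0] f[OF that, of 0] f[OF er(1,2)] er(3)
      length_pos[OF that] by simp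
  have kr: "0 \<le> k * r" "k * r \<le> pi / 2" using k_le[OF er(1,2)] by auto
  have "0 < a e * cos (k * r)" using le[OF e'(1)] e'(2) by simp
  moreover have "0 \<le> cos (k * r)" using kr by (intro cos_ge_zero) auto
  ultimately have a: "0 < a e" by (simp add: zero_less_mult_iff)
  have "\<not> 0 < r"
  proof
    assume "0 < r"
    then have "cos (k * r) < 1" using cos_monotone_0_pi[of 0 "k * r"] kr k by simp
    then have "a e * cos (k * r) < a e * 1" using a by (intro mult_strict_left_mono) auto
    then show False using le[OF er(1)] by simp
  qed
  then have "r = 0" using er(2) by simp
  then show ?thesis using er a full[OF er(1)] by auto
qed

text \<open>With \<open>k\<close> the root of the second eigenvalue, the two bounds give
  \<open>pi / 2 \<le> k * L e1\<close> and \<open>k * L e1 + k * l2 \<le> pi\<close>. If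
  \<open>l2 = L e1\<close> they fix \<open>k\<close>; otherwise the sign of the value
  \<open>c\<close> at \<open>v0\<close> decides which extremum lies at the leaf of
  \<open>e1\<close>.\<close>

lemma mg_dist_extrema:
  assumes \<psi>: "\<psi> \<in> eigenspace G L (mu G L 2)" "\<psi> \<noteq> (\<lambda>z. 0)"
    and x: "x \<in> mg_points G L" "\<And>z. z \<in> mg_points G L \<Longrightarrow> \<psi> z \<le> \<psi> x"
    and y: "y \<in> mg_points G L" "\<And>z. z \<in> mg_points G L \<Longrightarrow> \<psi> y \<le> \<psi> z"
  shows "mg_dist G L x y = L e1 + l2"
proof -
  obtain k0 where k0: "0 < k0" "k0 \<le> pi / (L e1 + l2)" "k0\<^sup>2 \<in> eigenvalues G L"
    using secular_eigenvalue by auto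
  have lower: "(pi / (2 * L e1))\<^sup>2 \<le> mu G L 2" and upper: "mu G L 2 \<le> k0\<^sup>2"
    using mu_2_bounds[OF e1 le_L1 k0(1,3)] by auto
  define k where "k = sqrt (mu G L 2)"
  have lower': "pi / (2 * L e1) \<le> k" unfolding k_def using lower by (rule real_le_rsqrt)
  moreover have "0 < pi / (2 * L e1)" using L1_pos by simp
  ultimately have kpos: "0 < k" by linarith
  have k_low: "pi / 2 \<le> k * L e1" using lower' L1_pos by (simp add: field_simps)
  have "k \<le> k0" unfolding k_def using upper k0(1) by (intro real_le_lsqrt) auto
  then have "k \<le> pi / (L e1 + l2)" using k0(2) by simp
  then have k_up: "k * L e1 + k * l2 \<le> pi" using L1_pos l2_nonneg by (simp add: field_simps)
  have mu: "mu G L 2 = k\<^sup>2" using kpos by (simp add: k_def)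
  obtain a c where "\<forall>e\<in>arcs G. \<forall>r\<in>{0..L e}. \<psi> (leaf_pt e r) = a e * cos (k * r)"
    and "\<forall>e\<in>arcs G. a e * cos (k * L e) = c" and sum: "(\<Sum>e\<in>arcs G. a e * sin (k * L e)) = 0"
    by (rule eigenspace_posE[OF \<psi>(1)[unfolded mu] kpos])
  note a = this(1)[rule_format] and c = this(2)[rule_format]
  have ne: "\<exists>e\<in>arcs G. a e \<noteq> 0" by (rule eigenfunction_nonzero[OF \<psi> a])
  have a': "- \<psi> (leaf_pt e r) = - a e * cos (k * r)" if "e \<in> arcs G" "r \<in> {0..L e}" for e r
    using a[OF that] by simp
  have sum': "(\<Sum>e\<in>arcs G. - a e * sin (k * L e)) = 0" using sum by (simp add: sum_negf)
  show ?thesis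
  proof (cases "l2 = L e1")
    case True
    then have keq: "k * L e1 = pi / 2" using k_low k_up by simp
    have "c = 0" using c[OF e1] unfolding keq by simp
    then have c0: "a e * cos (k * L e) = 0" if "e \<in> arcs G" for e using c[OF that] by simp
    obtain e where e: "e \<in> arcs G" "L e = L e1" "0 < a e" "x = leaf_pt e 0"
      using maximum_balanced[OF kpos keq a c0 sum ne x] by auto
    have "\<exists>e\<in>arcs G. L e = L e1 \<and> 0 < - a e \<and> y = leaf_pt e 0"
      by (rule maximum_balanced[OF kpos keq a' _ sum' _ y(1)]) (use c0 ne y(2) in auto)
    then obtain e' where e': "e' \<in> arcs G" "L e' = L e1" "0 < - a e'" "y = leaf_pt e' 0" by auto
    \<comment> \<open>The amplitudes have opposite signs, so the two extrema lie on different
      edges.\<close>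
    have "e \<noteq> e'" using e e' by auto
    then show ?thesis
      using mg_dist_two_edges[of e 0 e' 0] e e' L1_pos True by simp
  next
    case False
    then have lt: "l2 < L e1" using l2_le by simp
    have dist: "mg_dist G L u v = L e1 + l2 \<and> mg_dist G L v u = L e1 + l2"
      if "v = leaf_pt e1 0" "arcs G = {e1} \<and> u = leaf_pt e1 (L e1) \<or>
        (\<exists>e\<in>arcs G. e \<noteq> e1 \<and> L e = l2 \<and> u = leaf_pt e 0)" for u v
      using that(2)
    proof
      assume *: "arcs G = {e1} \<and> u = leaf_pt e1 (L e1)"
      then have "l2 = 0" using l2_cases by auto
      then show ?thesis
        using * that(1) mg_dist_same_edge[OF e1, of 0 "L e1"] mg_dist_same_edge[OF e1, of "L e1" 0] L1_pos
        by simp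
    next
      assume "\<exists>e\<in>arcs G. e \<noteq> e1 \<and> L e = l2 \<and> u = leaf_pt e 0"
      then obtain e where e: "e \<in> arcs G" "e \<noteq> e1" "L e = l2" "u = leaf_pt e 0" by auto
      then show ?thesis
        using that(1) mg_dist_two_edges[of e 0 e1 0] mg_dist_two_edges[of e1 0 e 0] e1 L1_pos l2_nonneg
        by simp
    qed
    consider "0 < c" | "0 < - c" | "c = 0" by linarith
    then show ?thesis
    proof cases
      case 1
      show ?thesis
        using dist[OF extrema_strict[OF lt kpos k_low k_up a c 1 sum x y]] by simp
    next
      case 2
      \<comment> \<open>Negating the eigenfunction makes its value at \<open>v0\<close> positive and
        exchanges the roles of \<open>x\<close> and \<open>y\<close>.\<close>
      have c': "- a e * cos (k * L e) = - c" if "e \<in> arcs G" for e using c[OF that] by simp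
      have y': "- \<psi> z \<le> - \<psi> y" and x': "- \<psi> x \<le> - \<psi> z" if "z \<in> mg_points G L" for z
        using x(2)[OF that] y(2)[OF that] by auto
      show ?thesis
        using dist[OF extrema_strict[of k "\<lambda>z. - \<psi> z", OF lt kpos k_low k_up a' c' 2 sum' y(1) y' x(1) x']]
        by simp
    next
      case 3
      \<comment> \<open>This case is contradictory: edges other than \<open>e1\<close> have nonzero
        cosine and hence zero amplitude, after which sine and cosine on \<open>e1\<close> would both
        have to vanish unless \<open>a e1 = 0\<close>.\<close>
      have kl2: "k * l2 < pi / 2" using mult_strict_left_mono[OF lt kpos] k_up by linarith
      have zero: "a e = 0" if e: "e \<in> arcs G" "e \<noteq> e1" for e
      proof -
        have "k * L e \<le> k * l2" using le_l2[OF e] kpos by simp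
        then have "k * L e < pi / 2" using kl2 by linarith
        then have "0 < cos (k * L e)" using kpos length_pos[OF e(1)] by (intro cos_gt_zero) auto
        then show ?thesis using c[OF e(1)] 3 by simp
      qed
      then have "a e1 * sin (k * L e1) = 0"
        using sum e1 by (subst (asm) sum.remove[of _ e1]) auto
      moreover have "a e1 * cos (k * L e1) = 0" using c[OF e1] 3 by simp
      ultimately have "a e1 = 0" using sin_zero_abs_cos_one[of "k * L e1"] by auto
      then show ?thesis using zero ne by blast
    qed
  qed
qed

end

theorem proposition4p12:
  fixes G :: "('v, 'e) pre_digraph" and L :: "'e \<Rightarrow> real"
    and \<psi> :: "('v, 'e) mg_point \<Rightarrow> real" and x y :: "('v, 'e) mg_point"
  assumes "star_graph G L"
    and "\<psi> \<in> eigenspace G L (mu G L 2)" and "\<psi> \<noteq> (\<lambda>z. 0)"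
    and "x \<in> mg_points G L" and "\<forall>z\<in>mg_points G L. \<psi> z \<le> \<psi> x"
    and "y \<in> mg_points G L" and "\<forall>z\<in>mg_points G L. \<psi> y \<le> \<psi> z"
  shows "mg_dist G L x y = mg_diam G L"
proof -
  obtain v0 leaf where "star_metric_graph G L v0 leaf"
    using assms(1) by (rule star_graphE)
  then interpret star_metric_graph G L v0 leaf .
  have "Max (L ` arcs G) \<in> L ` arcs G"
    using nonempty by (intro Max_in) auto
  then obtain e1 where e1: "e1 \<in> arcs G" "L e1 = Max (L ` arcs G)" by auto
  \<comment> \<open>The case distinction avoids \<open>Max\<close> of the empty set. Only
    \<open>e1\<close> itself is removed, so another edge of the same length yields
    \<open>l2 = L e1\<close>.\<close>
  define l2 where "l2 = (if arcs G = {e1} then 0 else Max (L ` (arcs G - {e1})))"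
  have le_l2: "L e \<le> l2" if "e \<in> arcs G" "e \<noteq> e1" for e
    using that by (auto simp: l2_def)
  have l2_cases: "arcs G = {e1} \<and> l2 = 0 \<or> (\<exists>e2\<in>arcs G. e2 \<noteq> e1 \<and> L e2 = l2)"
  proof (cases "arcs G = {e1}")
    case False
    then have "Max (L ` (arcs G - {e1})) \<in> L ` (arcs G - {e1})"
      using e1 by (intro Max_in) auto
    then show ?thesis using False by (auto simp: l2_def)
  qed (simp add: l2_def)
  interpret star_two_longest G L v0 leaf e1 l2
  proof
    show "L e \<le> L e1" if "e \<in> arcs G" for e
      using that by (simp add: e1(2))
    show "e1 \<in> arcs G" by (rule e1(1))
    show "arcs G = {e1} \<and> l2 = 0 \<or> (\<exists>e2\<in>arcs G. e2 \<noteq> e1 \<and> L e2 = l2)" by (rule l2_cases)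
    show "L e \<le> l2" if "e \<in> arcs G" "e \<noteq> e1" for e using that by (rule le_l2)
  qed
  show ?thesis
    using assms mg_dist_extrema[of \<psi> x y] by (intro mg_diam_eqI) auto
qed

end
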